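(* Let $(p,q)\in\mathbb{R}^2$ with $q>p$ and $(p,q)\notin\{(1,2),(-2,-1),(-2,2)\}$. Then the function $r\mapsto\Theta(p,q,r)$ is strictly decreasing on $(1,\infty)$ if and only if $$p^2-pq+q^2+3p-3q\le 0.$$
   Context: For $q>p$ and $r>1$, the period integral is $$\Theta(p,q,r)=\int_1^r\frac{dx}{\sqrt{I(x)}},$$ where $$I(x)=\begin{cases}\Big(1+\frac{r^q-1}{r^p-1}(x^p-1)\Big)^{2/q}-x^2,& pq\ne0,\\[4pt] \Big(1+\frac{r^q-1}{\log r}\log x\Big)^{2/q}-x^2,& p=0,\\[4pt] r^{\frac{2(x^p-1)}{r^p-1}}-x^2,& q=0.\end{cases}$$ One has $I>0$ on $(1,r)$, $I(1)=I(r)=0$, and the integral is finite. *)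

theory Defs
  imports "HOL-Analysis.Analysis"
begin

text \<open>
  Used for \<open>p < q\<close>, \<open>r > 1\<close>, \<open>1 \<le> x \<le> r\<close>; there every base of \<open>powr\<close> is positive. Since
  \<open>p < q\<close>, at most one of \<open>p\<close> and \<open>q\<close> vanishes.
\<close>

definition period_radicand :: "real \<Rightarrow> real \<Rightarrow> real \<Rightarrow> real \<Rightarrow> real" where
  "period_radicand p q r x =
     (if p * q \<noteq> 0 then
        (1 + (r powr q - 1) / (r powr p - 1) * (x powr p - 1)) powr (2 / q) - x\<^sup>2
      else if p = 0 then
        (1 + (r powr q - 1) / ln r * ln x) powr (2 / q) - x\<^sup>2
      else
        r powr (2 * (x powr p - 1) / (r powr p - 1)) - x\<^sup>2)"

text \<open>
  The radicand vanishes at both endpoints, so the classical integral is improper. The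
  Henstock--Kurzweil integral subsumes this improper integral, and it ignores the value \<open>1 / 0 = 0\<close>
  at the two endpoints.
\<close>

definition Theta :: "real \<Rightarrow> real \<Rightarrow> real \<Rightarrow> real" where
  "Theta p q r = integral {1..r} (\<lambda>x. 1 / sqrt (period_radicand p q r x))"

end

theory Submission
  imports Defs
begin

text \<open>
  Put \<open>I = x\<^sup>2 (M - 1)\<close> and \<open>\<zeta> = x M' / (2 M)\<close>. In all three cases
  \<open>x \<zeta>' = - Q \<zeta>\<close> with \<open>Q \<zeta> = (1 + \<zeta>) (q \<zeta> + q - p)\<close>, so that \<open>ln M / 2 + A \<zeta>\<close> is a constant
  \<open>h\<close>, where \<open>A' \<zeta> = \<zeta> / Q \<zeta>\<close> and \<open>A 0 = 0\<close>. Substituting \<open>exp (2 A \<zeta>) - 1 = E sin\<^sup>2 t\<close> with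
  \<open>E = exp (2 h) - 1\<close> on each side of the zero of \<open>\<zeta>\<close> turns the period into the integral of
  \<open>J (k t)\<close> over \<open>0 < t < \<pi> / 2\<close>, where \<open>exp (2 k t) - 1 = E sin\<^sup>2 t\<close> and
  \<open>J k = (1 / \<zeta>\<^sub>+ - 1 / \<zeta>\<^sub>-) sqrt (1 - exp (- 2 k))\<close> for the two solutions
  \<open>\<zeta>\<^sub>- < 0 < \<zeta>\<^sub>+\<close> of \<open>A \<zeta> = k\<close>. As \<open>r\<close> grows, \<open>h\<close> grows, so everything depends on the
  monotonicity of \<open>J\<close>.

  The reciprocals \<open>1 / \<zeta>\<^sub>\<plusminus>\<close>, scaled and shifted, become solutions \<open>s > 0\<close> and \<open>- n < 0\<close> of
  \<open>y' = - (y\<^sup>3 / 2 - c y - D)\<close>, a cubic without quadratic term, and the quadratic inequality of the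
  theorem says precisely that \<open>c \<le> 1\<close>; moreover \<open>c = 1\<close>, \<open>D = 0\<close> are the three excluded points,
  for which \<open>J\<close> is constant. If \<open>D \<ge> 0\<close>, then \<open>0 \<le> s - n\<close> and \<open>s n (s - n) \<le> 2 D\<close>. Since
  \<open>(s + n)' = - \<rho> (s + n) / 2\<close> for \<open>\<rho> = s\<^sup>2 - s n + n\<^sup>2 - 2 c\<close>, the sign of \<open>J'\<close> is that of
  \<open>1 / \<rho> - (exp (2 k) - 1) / 2\<close>, which the identity
  \<open>\<rho>' + \<rho>\<^sup>2 + 2 \<rho> = (2 - 2 c) \<rho> + 3 / 2 (s - n) (2 D - s n (s - n))\<close> decides by comparison with
  \<open>y' = 1 + 2 y\<close>.
\<close>

section \<open>A pair of solutions of a cubic equation\<close>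

text \<open>The product with the integrating factor \<open>exp (k * y)\<close> is nondecreasing, and
  the limit at 0 fixes its sign. A one-sided limit is assumed because the functions compared below
  are built from ones that blow up at 0.\<close>

lemma linear_diff_ineq_nonneg:
  fixes f f' :: "real \<Rightarrow> real"
  assumes der: "\<And>x. 0 < x \<Longrightarrow> x < H \<Longrightarrow> (f has_real_derivative f' x) (at x)"
    and ineq: "\<And>x. 0 < x \<Longrightarrow> x < H \<Longrightarrow> 0 \<le> f' x + k * f x"
    and lim: "(f \<longlongrightarrow> 0) (at_right 0)"
    and x: "0 < x" "x < H"
  shows "0 \<le> f x"
proof -
  define F where "F y = f y * exp (k * y)" for y
  have mono: "F y \<le> F x" if "0 < y" "y \<le> x" for y
  proof (rule DERIV_nonneg_imp_nondecreasing[OF that(2)])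
    fix z assume z: "y \<le> z" "z \<le> x"
    have "(F has_real_derivative (f' z + k * f z) * exp (k * z)) (at z)"
      unfolding F_def using der[of z] z that x
      by (auto intro!: derivative_eq_intros simp: algebra_simps)
    moreover have "0 \<le> (f' z + k * f z) * exp (k * z)"
      using ineq[of z] z that x by auto
    ultimately show "\<exists>d. (F has_real_derivative d) (at z) \<and> 0 \<le> d" by blast
  qed
  have "((\<lambda>y. exp (k * y)) \<longlongrightarrow> exp (k * 0)) (at_right 0)"
    by (intro tendsto_intros)
  then have "(F \<longlongrightarrow> 0 * exp (k * 0)) (at_right 0)"
    unfolding F_def by (intro tendsto_mult lim)
  moreover have "eventually (\<lambda>y. F y \<le> F x) (at_right 0)"
    using eventually_at_right_less[of 0] eventually_at_rightI[of 0 x "\<lambda>y. F y \<le> F x"] mono x by auto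
  ultimately have "0 \<le> F x"
    by (auto intro: tendsto_upperbound)
  then show ?thesis
    by (simp add: F_def zero_le_mult_iff)
qed

text \<open>The integrating factor makes the product strictly increase from \<open>x / 2\<close> to
  \<open>x\<close>; the weak version supplies the sign at \<open>x / 2\<close>.\<close>

lemma linear_diff_ineq_pos:
  fixes f f' :: "real \<Rightarrow> real"
  assumes der: "\<And>x. 0 < x \<Longrightarrow> x < H \<Longrightarrow> (f has_real_derivative f' x) (at x)"
    and ineq: "\<And>x. 0 < x \<Longrightarrow> x < H \<Longrightarrow> 0 < f' x + k * f x"
    and lim: "(f \<longlongrightarrow> 0) (at_right 0)"
    and x: "0 < x" "x < H"
  shows "0 < f x"
proof -
  define F where "F y = f y * exp (k * y)" for y
  have "F (x / 2) < F x"
  proof (rule DERIV_pos_imp_increasing[where f = F])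
    fix z assume z: "x / 2 \<le> z" "z \<le> x"
    have "(F has_real_derivative (f' z + k * f z) * exp (k * z)) (at z)"
      unfolding F_def using der[of z] z x
      by (auto intro!: derivative_eq_intros simp: algebra_simps)
    moreover have "0 < (f' z + k * f z) * exp (k * z)"
      using ineq[of z] z x by auto
    ultimately show "\<exists>d. (F has_real_derivative d) (at z) \<and> 0 < d" by blast
  qed (use x in auto)
  moreover have "0 \<le> f (x / 2)"
    by (rule linear_diff_ineq_nonneg[OF der less_imp_le[OF ineq] lim]) (use x in auto)
  ultimately show ?thesis
    by (smt (verit) F_def exp_gt_zero mult_nonneg_nonneg mult_pos_pos zero_less_mult_iff)
qed

text \<open>\<open>s\<close> and \<open>- n\<close> solve the same equation, and the two cubic
  conditions say that \<open>s\<close> and \<open>n\<close> decrease. The sign of \<open>D\<close>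
  is a normalisation: the other sign is reached by exchanging the two functions.\<close>

locale cubic_pair =
  fixes s n :: "real \<Rightarrow> real" and c D H :: real
  assumes H: "0 < H"
    and D: "0 \<le> D"
    and s': "\<And>h. 0 < h \<Longrightarrow> h < H \<Longrightarrow> (s has_real_derivative - (s h ^ 3 / 2 - c * s h - D)) (at h)"
    and n': "\<And>h. 0 < h \<Longrightarrow> h < H \<Longrightarrow> (n has_real_derivative - (n h ^ 3 / 2 - c * n h + D)) (at h)"
    and s_pos: "\<And>h. 0 < h \<Longrightarrow> h < H \<Longrightarrow> 0 < s h"
    and n_pos: "\<And>h. 0 < h \<Longrightarrow> h < H \<Longrightarrow> 0 < n h"
    and s_cubic: "\<And>h. 0 < h \<Longrightarrow> h < H \<Longrightarrow> 0 < s h ^ 3 / 2 - c * s h - D"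
    and n_cubic: "\<And>h. 0 < h \<Longrightarrow> h < H \<Longrightarrow> 0 < n h ^ 3 / 2 - c * n h + D"
    and s_lim: "filterlim s at_top (at_right 0)"
    and n_lim: "filterlim n at_top (at_right 0)"
begin

section \<open>Comparison of the two solutions through their reciprocals\<close>

lemma recip_lim:
  "((\<lambda>h. 1 / s h) \<longlongrightarrow> 0) (at_right 0)" "((\<lambda>h. 1 / n h) \<longlongrightarrow> 0) (at_right 0)"
  using s_lim n_lim
  by (auto intro!: tendsto_divide_0[OF tendsto_const] filterlim_at_top_imp_at_infinity)

lemma recip_deriv:
  assumes "0 < h" "h < H"
  shows "((\<lambda>h. 1 / s h) has_real_derivative
          (1 - 2 * c * (1 / s h)\<^sup>2 - 2 * D * (1 / s h) ^ 3) / (2 * (1 / s h))) (at h)"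
    and "((\<lambda>h. 1 / n h) has_real_derivative
          (1 - 2 * c * (1 / n h)\<^sup>2 + 2 * D * (1 / n h) ^ 3) / (2 * (1 / n h))) (at h)"
  using s'[OF assms] n'[OF assms] s_pos[OF assms] n_pos[OF assms]
  by (auto intro!: derivative_eq_intros simp: field_simps power2_eq_square power3_eq_cube)

lemma recip_cubic:
  assumes "0 < h" "h < H"
  shows "0 < 1 - 2 * c * (1 / s h)\<^sup>2 - 2 * D * (1 / s h) ^ 3"
    and "0 < 1 - 2 * c * (1 / n h)\<^sup>2 + 2 * D * (1 / n h) ^ 3"
proof -
  have "1 - 2 * c * (1 / s h)\<^sup>2 - 2 * D * (1 / s h) ^ 3 = 2 * (s h ^ 3 / 2 - c * s h - D) / s h ^ 3"
    using s_pos[OF assms] by (simp add: field_simps power2_eq_square power3_eq_cube)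
  then show "0 < 1 - 2 * c * (1 / s h)\<^sup>2 - 2 * D * (1 / s h) ^ 3"
    using s_pos[OF assms] s_cubic[OF assms] by simp
  have "1 - 2 * c * (1 / n h)\<^sup>2 + 2 * D * (1 / n h) ^ 3 = 2 * (n h ^ 3 / 2 - c * n h + D) / n h ^ 3"
    using n_pos[OF assms] by (simp add: field_simps power2_eq_square power3_eq_cube)
  then show "0 < 1 - 2 * c * (1 / n h)\<^sup>2 + 2 * D * (1 / n h) ^ 3"
    using n_pos[OF assms] n_cubic[OF assms] by simp
qed

definition "x = (\<lambda>h. 1 / s h)"
definition "y = (\<lambda>h. 1 / n h)"

lemma xy_pos: "0 < h \<Longrightarrow> h < H \<Longrightarrow> 0 < x h" "0 < h \<Longrightarrow> h < H \<Longrightarrow> 0 < y h"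
  using s_pos n_pos by (auto simp: x_def y_def)

lemma x': "0 < h \<Longrightarrow> h < H \<Longrightarrow>
    (x has_real_derivative (1 - 2 * c * (x h)\<^sup>2 - 2 * D * (x h) ^ 3) / (2 * x h)) (at h)"
  and y': "0 < h \<Longrightarrow> h < H \<Longrightarrow>
    (y has_real_derivative (1 - 2 * c * (y h)\<^sup>2 + 2 * D * (y h) ^ 3) / (2 * y h)) (at h)"
  unfolding x_def y_def by (fact recip_deriv)+

text \<open>This has the sign of \<open>s h - n h\<close>. Reciprocals turn the blow-up at 0 into
  the limit 0, and their squares satisfy a relation that is linear in the difference, with the
  nonnegative source \<open>2 * D * ((x h) ^ 3 + (y h) ^ 3)\<close>.\<close>

definition "gap h = (y h)\<^sup>2 - (x h)\<^sup>2"

lemma gap':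
  assumes "0 < h" "h < H"
  shows "(gap has_real_derivative 2 * D * ((x h) ^ 3 + (y h) ^ 3) - 2 * c * gap h) (at h)"
  unfolding gap_def using x'[OF assms] y'[OF assms] xy_pos[OF assms]
  by (auto intro!: derivative_eq_intros simp: field_simps power2_eq_square power3_eq_cube)

lemma gap_lim: "(gap \<longlongrightarrow> 0) (at_right 0)"
  unfolding gap_def x_def y_def
  by (rule tendsto_eq_intros recip_lim | simp)+

text \<open>This has the sign of \<open>2 * D - s h * n h * (s h - n h)\<close>. Like
  \<open>gap\<close>, it tends to 0 and satisfies a linear equation with coefficient
  \<open>2 * c\<close> and a nonnegative source.\<close>

definition "slack h = 2 * D * ((x h)\<^sup>2 * (y h)\<^sup>2 * (x h + y h)) - gap h"

lemma slack':
  assumes "0 < h" "h < H"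
  shows "(slack has_real_derivative
    3 * D * (x h * y h) *
      (y h * (1 - 2 * c * (x h)\<^sup>2 - 2 * D * (x h) ^ 3) + x h * (1 - 2 * c * (y h)\<^sup>2 + 2 * D * (y h) ^ 3))
    - 2 * c * slack h) (at h)"
proof -
  define X Y where "X = x h" and "Y = y h"
  define PX PY where "PX = 1 - 2 * c * X\<^sup>2 - 2 * D * X ^ 3" and "PY = 1 - 2 * c * Y\<^sup>2 + 2 * D * Y ^ 3"
  have pos: "0 < X" "0 < Y" using xy_pos[OF assms] by (auto simp: X_def Y_def)
  have half: "PX / (2 * X) * X = PX / 2" "PY / (2 * Y) * Y = PY / 2" using pos by auto
  have "(slack has_real_derivative
      2 * D * ((2 * X * (PX / (2 * X)) * Y\<^sup>2 + X\<^sup>2 * (2 * Y * (PY / (2 * Y)))) * (X + Y)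
        + X\<^sup>2 * Y\<^sup>2 * (PX / (2 * X) + PY / (2 * Y)))
      - (2 * D * (X ^ 3 + Y ^ 3) - 2 * c * gap h)) (at h)"
    unfolding slack_def using x'[OF assms] y'[OF assms] gap'[OF assms]
    unfolding X_def[symmetric] Y_def[symmetric] PX_def[symmetric] PY_def[symmetric]
    by (auto intro!: derivative_eq_intros simp: X_def Y_def algebra_simps)
  moreover have "2 * D * ((2 * X * (PX / (2 * X)) * Y\<^sup>2 + X\<^sup>2 * (2 * Y * (PY / (2 * Y)))) * (X + Y)
        + X\<^sup>2 * Y\<^sup>2 * (PX / (2 * X) + PY / (2 * Y)))
      = 2 * D * ((PX * Y\<^sup>2 + X\<^sup>2 * PY) * (X + Y) + (PX * X * Y\<^sup>2 + PY * Y * X\<^sup>2) / 2)"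
    using pos by (simp add: field_simps power2_eq_square)
  moreover have "2 * D * ((PX * Y\<^sup>2 + X\<^sup>2 * PY) * (X + Y) + (PX * X * Y\<^sup>2 + PY * Y * X\<^sup>2) / 2)
      - (2 * D * (X ^ 3 + Y ^ 3) - 2 * c * gap h)
      = 3 * D * (X * Y) * (Y * PX + X * PY) - 2 * c * slack h"
    unfolding slack_def gap_def X_def[symmetric] Y_def[symmetric] PX_def PY_def
    by (simp add: field_simps power2_eq_square power3_eq_cube)
  ultimately show ?thesis
    unfolding X_def Y_def PX_def PY_def by (simp only:)
qed

lemma slack_lim: "(slack \<longlongrightarrow> 0) (at_right 0)"
  unfolding slack_def using gap_lim recip_lim unfolding x_def[symmetric] y_def[symmetric]
  by (auto intro!: tendsto_eq_intros)

lemma gap_nonneg: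
  assumes "0 < h" "h < H"
  shows "0 \<le> gap h"
proof (rule linear_diff_ineq_nonneg[OF gap' _ gap_lim assms])
  fix u assume u: "0 < u" "u < H"
  then show "0 \<le> 2 * D * ((x u) ^ 3 + (y u) ^ 3) - 2 * c * gap u + (2 * c) * gap u"
    using xy_pos[OF u] D by simp
qed

lemma gap_pos:
  assumes "0 < D" "0 < h" "h < H"
  shows "0 < gap h"
proof (rule linear_diff_ineq_pos[OF gap' _ gap_lim assms(2,3)])
  fix u assume u: "0 < u" "u < H"
  then show "0 < 2 * D * ((x u) ^ 3 + (y u) ^ 3) - 2 * c * gap u + (2 * c) * gap u"
    using xy_pos[OF u] assms by (simp add: add_pos_pos)
qed

text \<open>
  The two cubics, divided by \<open>s\<^sup>3 / 2\<close> and \<open>n\<^sup>3 / 2\<close>, enter the derivative of \<open>slack\<close> in a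
  positive combination; this is why no a priori bound on \<open>c\<close> is needed.
\<close>

lemma cubic_mix_pos:
  assumes "0 < h" "h < H"
  shows "0 < (x h * y h) *
      (y h * (1 - 2 * c * (x h)\<^sup>2 - 2 * D * (x h) ^ 3) + x h * (1 - 2 * c * (y h)\<^sup>2 + 2 * D * (y h) ^ 3))"
  using xy_pos[OF assms] recip_cubic[OF assms]
  unfolding x_def y_def
  by (metis add_pos_pos mult_pos_pos)

lemma slack_nonneg:
  assumes "0 < h" "h < H"
  shows "0 \<le> slack h"
proof (rule linear_diff_ineq_nonneg[OF slack' _ slack_lim assms, where k = "2 * c"])
  fix u assume u: "0 < u" "u < H"
  show "0 \<le> 3 * D * (x u * y u) *
      (y u * (1 - 2 * c * (x u)\<^sup>2 - 2 * D * (x u) ^ 3) + x u * (1 - 2 * c * (y u)\<^sup>2 + 2 * D * (y u) ^ 3))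
    - 2 * c * slack u + 2 * c * slack u"
    using mult_nonneg_nonneg[OF D less_imp_le[OF cubic_mix_pos[OF u]]] by (simp add: mult.assoc)
qed

lemma slack_pos:
  assumes "0 < D" "0 < h" "h < H"
  shows "0 < slack h"
proof (rule linear_diff_ineq_pos[OF slack' _ slack_lim assms(2,3), where k = "2 * c"])
  fix u assume u: "0 < u" "u < H"
  show "0 < 3 * D * (x u * y u) *
      (y u * (1 - 2 * c * (x u)\<^sup>2 - 2 * D * (x u) ^ 3) + x u * (1 - 2 * c * (y u)\<^sup>2 + 2 * D * (y u) ^ 3))
    - 2 * c * slack u + 2 * c * slack u"
    using mult_pos_pos[OF assms(1) cubic_mix_pos[OF u]] by (simp add: mult.assoc)
qed

lemma gap_eq:
  assumes "0 < h" "h < H"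
  shows "gap h = (s h - n h) * ((s h + n h) / (s h * n h)\<^sup>2)"
    and "slack h = (2 * D - s h * n h * (s h - n h)) * ((s h + n h) / (s h * n h) ^ 3)"
  unfolding slack_def gap_def x_def y_def using s_pos[OF assms] n_pos[OF assms]
  by (simp_all add: field_simps power2_eq_square power3_eq_cube)

lemma weights_pos:
  assumes "0 < h" "h < H"
  shows "0 < (s h + n h) / (s h * n h)\<^sup>2" "0 < (s h + n h) / (s h * n h) ^ 3"
  using s_pos[OF assms] n_pos[OF assms] by auto

lemma diff_nonneg: "n h \<le> s h"
  and prod_le: "s h * n h * (s h - n h) \<le> 2 * D" if h: "0 < h" "h < H"
  using gap_nonneg[OF h] slack_nonneg[OF h] weights_pos[OF h]
  unfolding gap_eq(1)[OF h] gap_eq(2)[OF h]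
  by (metis diff_ge_0_iff_ge not_le zero_le_mult_iff)+

lemma diff_pos: "n h < s h"
  and prod_less: "s h * n h * (s h - n h) < 2 * D" if h: "0 < D" "0 < h" "h < H"
  using gap_pos[OF h] slack_pos[OF h] weights_pos[OF h(2,3)]
  unfolding gap_eq(1)[OF h(2,3)] gap_eq(2)[OF h(2,3)]
  by (metis diff_gt_0_iff_gt order.asym zero_less_mult_iff)+

definition "rate h = (s h)\<^sup>2 - s h * n h + (n h)\<^sup>2 - 2 * c"

text \<open>Half of \<open>rate h * (s h + n h)\<close> is the sum of the two cubics, which are both
  positive.\<close>

lemma rate_pos:
  assumes "0 < h" "h < H"
  shows "0 < rate h"
proof -
  have "rate h * (s h + n h) = 2 * ((s h ^ 3 / 2 - c * s h - D) + (n h ^ 3 / 2 - c * n h + D))"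
    by (simp add: rate_def algebra_simps power2_eq_square power3_eq_cube)
  also have "\<dots> > 0" using s_cubic[OF assms] n_cubic[OF assms] by simp
  finally show ?thesis using s_pos[OF assms] n_pos[OF assms] by (auto simp: zero_less_mult_iff)
qed

text \<open>
  The right-hand side of the identity for \<open>\<rho>\<close> in the introduction; \<open>rate\<close> is \<open>\<rho>\<close>.
\<close>

definition "drive h = (2 - 2 * c) * rate h + 3 / 2 * (s h - n h) * (2 * D - s h * n h * (s h - n h))"

lemma rate':
  assumes "0 < h" "h < H"
  shows "(rate has_real_derivative drive h - (rate h)\<^sup>2 - 2 * rate h) (at h)"
proof -
  have "(rate has_real_derivative
     2 * s h * (- (s h ^ 3 / 2 - c * s h - D)) - (- (s h ^ 3 / 2 - c * s h - D)) * n h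
     - s h * (- (n h ^ 3 / 2 - c * n h + D)) + 2 * n h * (- (n h ^ 3 / 2 - c * n h + D))) (at h)"
    unfolding rate_def using s'[OF assms] n'[OF assms]
    by (auto intro!: derivative_eq_intros)
  then show ?thesis
    by (rule DERIV_cong) (simp add: drive_def rate_def; algebra)
qed

lemma rate_lim: "filterlim rate at_top (at_right 0)"
proof (rule filterlim_at_top_mono)
  have "filterlim (\<lambda>h. (s h)\<^sup>2) at_top (at_right 0)"
    by (rule filterlim_pow_at_top[OF _ s_lim]) simp
  then have "filterlim (\<lambda>h. 1 / 2 * (s h)\<^sup>2) at_top (at_right 0)"
    by (rule filterlim_tendsto_pos_mult_at_top[OF tendsto_const, rotated]) simp
  then show "filterlim (\<lambda>h. - 2 * c + 1 / 2 * (s h)\<^sup>2) at_top (at_right 0)"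
    by (rule filterlim_tendsto_add_at_top[OF tendsto_const])
  \<comment> \<open>The difference of the two sides is half the sum of the squares of
    \<open>s h - n h\<close> and \<open>n h\<close>.\<close>
  have "1 / 2 * (s h)\<^sup>2 \<le> (s h)\<^sup>2 - s h * n h + (n h)\<^sup>2" for h
    using sum_power2_ge_zero[of "s h - n h" "n h"] by (simp add: power2_eq_square algebra_simps)
  then have "- 2 * c + 1 / 2 * (s h)\<^sup>2 \<le> rate h" for h
    unfolding rate_def by (smt (verit))
  then show "eventually (\<lambda>h. - 2 * c + 1 / 2 * (s h)\<^sup>2 \<le> rate h) (at_right 0)"
    by (intro always_eventually) simp
qed

text \<open>The first term solves \<open>y' = 1 + 2 y\<close> with \<open>y 0 = 0\<close>, whereas
  the reciprocal of \<open>rate\<close> satisfies that equation up to the error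
  \<open>- drive h / (rate h)\<^sup>2\<close>. Hence the sign of \<open>drive\<close> decides that
  of \<open>excess\<close>.\<close>

definition "excess h = (exp (2 * h) - 1) / 2 - 1 / rate h"

lemma excess':
  assumes "0 < h" "h < H"
  shows "(excess has_real_derivative drive h / (rate h)\<^sup>2 + 2 * excess h) (at h)"
proof -
  have "(excess has_real_derivative exp (2 * h) + (drive h - (rate h)\<^sup>2 - 2 * rate h) / (rate h)\<^sup>2) (at h)"
    unfolding excess_def using rate'[OF assms] rate_pos[OF assms]
    by (auto intro!: derivative_eq_intros simp: power2_eq_square minus_divide_left)
  moreover have "(drive h - (rate h)\<^sup>2 - 2 * rate h) / (rate h)\<^sup>2 = drive h / (rate h)\<^sup>2 - 1 - 2 / rate h"
    using rate_pos[OF assms] by (simp add: diff_divide_distrib power2_eq_square)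
  ultimately show ?thesis
    by (elim DERIV_cong) (simp add: excess_def)
qed

lemma excess_lim: "(excess \<longlongrightarrow> 0) (at_right 0)"
proof -
  have "((\<lambda>h. 1 / rate h) \<longlongrightarrow> 0) (at_right 0)"
    using rate_lim by (auto intro!: tendsto_divide_0[OF tendsto_const] filterlim_at_top_imp_at_infinity)
  moreover have "((\<lambda>h. (exp (2 * h) - 1) / 2) \<longlongrightarrow> (exp (2 * 0) - 1) / (2::real)) (at_right 0)"
    by (intro tendsto_intros) auto
  ultimately have "((\<lambda>h. (exp (2 * h) - 1) / 2 - 1 / rate h) \<longlongrightarrow> (exp (2 * 0) - 1) / 2 - 0) (at_right 0)"
    by (intro tendsto_diff)
  then show ?thesis
    by (simp add: excess_def[abs_def])
qed

lemma excess_pos: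
  assumes "\<And>h. 0 < h \<Longrightarrow> h < H \<Longrightarrow> 0 < drive h" "0 < h" "h < H"
  shows "0 < excess h"
proof (rule linear_diff_ineq_pos[OF excess' _ excess_lim assms(2,3), where k = "- 2"])
  fix u assume u: "0 < u" "u < H"
  then show "0 < drive u / (rate u)\<^sup>2 + 2 * excess u + - 2 * excess u"
    using assms(1)[OF u] rate_pos[OF u] by simp
qed

text \<open>The interval may be shorter than that of the locale, since for \<open>1 < c\<close> the
  sign of \<open>drive\<close> is controlled only near 0.\<close>

lemma excess_nonpos:
  assumes "H' \<le> H" "\<And>h. 0 < h \<Longrightarrow> h < H' \<Longrightarrow> drive h \<le> 0" "0 < h" "h < H'"
  shows "excess h \<le> 0"
proof -
  have "0 \<le> - excess h"
  proof (rule linear_diff_ineq_nonneg[where k = "- 2" and H = H' and f = "\<lambda>h. - excess h"])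
    fix u assume u: "0 < u" "u < H'"
    then show "((\<lambda>h. - excess h) has_real_derivative - (drive u / (rate u)\<^sup>2 + 2 * excess u)) (at u)"
      using excess'[of u] assms(1) by (auto intro!: derivative_eq_intros)
    show "0 \<le> - (drive u / (rate u)\<^sup>2 + 2 * excess u) + - 2 * - excess u"
      using assms(2)[OF u] by (simp add: divide_nonpos_nonneg)
  next
    show "((\<lambda>h. - excess h) \<longlongrightarrow> 0) (at_right 0)"
      using tendsto_minus[OF excess_lim] by simp
  qed (use assms in auto)
  then show ?thesis by simp
qed

text \<open>Up to a constant factor this is the square of \<open>J\<close>; squaring avoids
  differentiating a root.\<close>

definition "profile h = (s h + n h)\<^sup>2 * (1 - exp (- (2 * h)))"

lemma profile':
  assumes "0 < h" "h < H"
  shows "(profile has_real_derivative - (2 * (s h + n h)\<^sup>2 * rate h * exp (- (2 * h)) * excess h)) (at h)"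
proof -
  have der: "(profile has_real_derivative
     2 * (s h + n h) * (- (s h ^ 3 / 2 - c * s h - D) + - (n h ^ 3 / 2 - c * n h + D)) * (1 - exp (- (2 * h)))
     + (s h + n h)\<^sup>2 * (2 * exp (- (2 * h)))) (at h)"
    unfolding profile_def using s'[OF assms] n'[OF assms]
    by (auto intro!: derivative_eq_intros)
  have rate: "2 * (s h + n h) * (- (s h ^ 3 / 2 - c * s h - D) + - (n h ^ 3 / 2 - c * n h + D))
      = - (rate h * (s h + n h)\<^sup>2)"
    by (simp add: rate_def algebra_simps power2_eq_square power3_eq_cube)
  have excess: "2 * (rate h * exp (- (2 * h)) * excess h) = rate h * (1 - exp (- (2 * h))) - 2 * exp (- (2 * h))"
    using rate_pos[OF assms] by (simp add: excess_def field_simps exp_minus)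
  have "- (2 * (s h + n h)\<^sup>2 * rate h * exp (- (2 * h)) * excess h)
      = - (s h + n h)\<^sup>2 * (2 * (rate h * exp (- (2 * h)) * excess h))"
    by (simp only: mult_ac mult_minus_left)
  also have "\<dots> = - (rate h * (s h + n h)\<^sup>2) * (1 - exp (- (2 * h))) + (s h + n h)\<^sup>2 * (2 * exp (- (2 * h)))"
    unfolding excess by (simp add: algebra_simps)
  finally show ?thesis
    using der unfolding rate by (simp only:)
qed

text \<open>Both summands of \<open>drive\<close> are nonnegative. For \<open>c < 1\<close> the
  first is positive; for \<open>c = 1\<close> the constant \<open>D\<close> is positive and the
  strict forms of the two comparisons make the second positive.\<close>

lemma profile_strict_antimono:
  assumes "c \<le> 1" "c \<noteq> 1 \<or> D \<noteq> 0" "0 < h" "h < h'" "h' < H"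
  shows "profile h' < profile h"
proof (rule DERIV_neg_imp_decreasing[OF assms(4)])
  have drive: "0 < drive u" if u: "0 < u" "u < H" for u
  proof -
    note facts = rate_pos[OF u] diff_nonneg[OF u] prod_le[OF u]
    have nonneg: "0 \<le> (2 - 2 * c) * rate u"
      "0 \<le> 3 / 2 * (s u - n u) * (2 * D - s u * n u * (s u - n u))"
      using facts assms(1) by auto
    show ?thesis
    proof (cases "c = 1")
      case True
      then have "0 < D" using assms(2) D by simp
      then have "0 < 3 / 2 * (s u - n u) * (2 * D - s u * n u * (s u - n u))"
        using diff_pos[OF _ u] prod_less[OF _ u] by auto
      then show ?thesis using nonneg unfolding drive_def by linarith
    next
      case False
      then have "0 < (2 - 2 * c) * rate u" using facts assms(1) by auto
      then show ?thesis using nonneg unfolding drive_def by linarith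
    qed
  qed
  fix u assume u: "h \<le> u" "u \<le> h'"
  then have u': "0 < u" "u < H" using assms by auto
  have "0 < 2 * (s u + n u)\<^sup>2 * rate u * exp (- (2 * u)) * excess u"
    using rate_pos[OF u'] excess_pos[OF drive u'] s_pos[OF u'] n_pos[OF u']
    by (intro mult_pos_pos) auto
  then show "\<exists>d. (profile has_real_derivative d) (at u) \<and> d < 0"
    using profile'[OF u'] by (intro exI conjI) auto
qed

text \<open>Near 0 the second summand of \<open>drive\<close> stays bounded while
  \<open>rate\<close> tends to infinity, so for \<open>1 < c\<close> the negative first summand
  prevails.\<close>

lemma profile_mono_near_0:
  assumes "1 < c"
  obtains H' where "0 < H'" "H' \<le> H" "\<And>h h'. 0 < h \<Longrightarrow> h < h' \<Longrightarrow> h' < H' \<Longrightarrow> profile h \<le> profile h'"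
proof -
  \<comment> \<open>The threshold is the bound \<open>3 * D * (2 * D)\<close> for the second summand
    of \<open>drive\<close>, divided by the factor \<open>2 * c - 2\<close> of
    \<open>rate\<close>.\<close>
  have "eventually (\<lambda>h. max 1 (3 * D * (2 * D) / (2 * c - 2)) \<le> rate h \<and> 1 \<le> s h \<and> 1 \<le> n h) (at_right 0)"
    using rate_lim s_lim n_lim by (auto simp: filterlim_at_top eventually_conj_iff)
  then obtain H1 where H1: "0 < H1"
    "\<And>h. 0 < h \<Longrightarrow> h < H1 \<Longrightarrow> 3 * D * (2 * D) / (2 * c - 2) \<le> rate h \<and> 1 \<le> s h \<and> 1 \<le> n h"
    unfolding eventually_at_right_field by auto
  define H' where "H' = min H1 H"
  have H': "0 < H'" "H' \<le> H" "H' \<le> H1" using H1 H by (auto simp: H'_def)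
  have drive: "drive u \<le> 0" if u: "0 < u" "u < H'" for u
  proof -
    have u': "0 < u" "u < H" "u < H1" using u H' by auto
    have 1: "1 \<le> s u * n u" using H1(2)[OF u'(1,3)] by (metis mult_mono mult_1 zero_le_one order_trans)
    \<comment> \<open>Since \<open>s u * n u\<close> is at least 1, the bound on
      \<open>s u * n u * (s u - n u)\<close> also bounds the difference alone.\<close>
    have 2: "s u - n u \<le> 2 * D"
      using prod_le[OF u'(1,2)] diff_nonneg[OF u'(1,2)] mult_right_mono[OF 1, of "s u - n u"] by simp
    have "3 / 2 * (s u - n u) * (2 * D - s u * n u * (s u - n u)) \<le> 3 / 2 * (2 * D) * (2 * D)"
      using 1 2 diff_nonneg[OF u'(1,2)] prod_le[OF u'(1,2)] D
      by (intro mult_mono) (auto intro!: mult_nonneg_nonneg)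
    moreover have "3 * D * (2 * D) \<le> (2 * c - 2) * rate u"
      using H1(2)[OF u'(1,3)] assms by (simp add: field_simps)
    moreover have "(2 - 2 * c) * rate u = - ((2 * c - 2) * rate u)" by (simp add: algebra_simps)
    ultimately show ?thesis unfolding drive_def by linarith
  qed
  have "profile h \<le> profile h'" if h: "0 < h" "h < h'" "h' < H'" for h h'
  proof (rule DERIV_nonneg_imp_nondecreasing[where f = profile])
    fix u assume u: "h \<le> u" "u \<le> h'"
    then have u': "0 < u" "u < H" "u < H'" using h H' by auto
    have "2 * (s u + n u)\<^sup>2 * rate u * exp (- (2 * u)) * excess u \<le> 0"
      using rate_pos[OF u'(1,2)] excess_nonpos[OF H'(2) drive u'(1,3)]
      by (intro mult_nonneg_nonpos) auto
    then show "\<exists>d. (profile has_real_derivative d) (at u) \<and> 0 \<le> d"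
      using profile'[OF u'(1,2)] by (intro exI conjI) auto
  qed (use h in auto)
  then show ?thesis using that H' by blast
qed

end

section \<open>The energy function and its two inverse branches\<close>

text \<open>The derivative of \<open>f\<close> may vanish at 0, as that of the energy does, so
  \<open>g\<close> need not be differentiable there and only its limit is claimed.\<close>

lemma inverse_branch:
  fixes f f' g :: "real \<Rightarrow> real"
  assumes u: "0 < u" and f0: "f 0 = 0"
    and der: "\<And>z. 0 \<le> z \<Longrightarrow> z \<le> u \<Longrightarrow> (f has_real_derivative f' z) (at z)"
    and pos: "\<And>z. 0 < z \<Longrightarrow> z \<le> u \<Longrightarrow> 0 < f' z"
    and g: "\<And>z. 0 \<le> z \<Longrightarrow> z \<le> u \<Longrightarrow> g (f z) = z"
  shows "0 < h \<Longrightarrow> h < f u \<Longrightarrow> 0 < g h \<and> g h < u \<and> f (g h) = h"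
    and "0 < h \<Longrightarrow> h < f u \<Longrightarrow> (g has_real_derivative inverse (f' (g h))) (at h)"
    and "(g \<longlongrightarrow> 0) (at_right 0)"
proof -
  have cont: "continuous_on {0..u} f"
    using der by (intro DERIV_continuous_on[where D = f']) (auto intro: has_field_derivative_at_within)
  have less: "f y < f z" if "0 \<le> y" "y < z" "z \<le> u" for y z
  proof (rule DERIV_pos_imp_increasing_open[OF that(2)])
    show "\<exists>d. (f has_real_derivative d) (at w) \<and> 0 < d" if "y < w" "w < z" for w
      using der[of w] pos[of w] that \<open>0 \<le> y\<close> \<open>z \<le> u\<close> by (intro exI[of _ "f' w"]) auto
    show "continuous_on {y..z} f"
      by (rule continuous_on_subset[OF cont]) (use that in auto)
  qed
  show inv: "0 < g h \<and> g h < u \<and> f (g h) = h" if h: "0 < h" "h < f u" for h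
  proof -
    obtain z where z: "0 \<le> z" "z \<le> u" "f z = h"
      using IVT'[of f 0 h u] cont f0 h u by auto
    moreover have "z \<noteq> 0" "z \<noteq> u" using z f0 h by auto
    ultimately show ?thesis using g[of z] by auto
  qed
  show "(g has_real_derivative inverse (f' (g h))) (at h)" if h: "0 < h" "h < f u" for h
  proof (rule DERIV_inverse_function[where a = 0 and b = "f u"])
    define z where "z = g h"
    have z: "0 < z" "z < u" "f z = h" using inv[OF h] by (auto simp: z_def)
    show "(f has_real_derivative f' (g h)) (at (g h))" "f' (g h) \<noteq> 0"
      using der[of z] pos[of z] z by (auto simp: z_def[symmetric])
    have "isCont g (f z)"
    proof (rule isCont_inverse_function[where f = f and g = g and x = z and d = "min z (u - z) / 2"])
      fix w assume "\<bar>w - z\<bar> \<le> min z (u - z) / 2"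
      then have w: "0 \<le> w" "w \<le> u"
        using z min.cobounded1[of z "u - z"] min.cobounded2[of z "u - z"] by (smt (verit) field_sum_of_halves)+
      show "g (f w) = w" "isCont f w" using g[OF w] DERIV_isCont[OF der[OF w]] by auto
    qed (use z in auto)
    then show "isCont g h" using z by simp
    show "f (g y) = y" if "0 < y" "y < f u" for y using inv[OF that] by simp
  qed (use h in auto)
  show "(g \<longlongrightarrow> 0) (at_right 0)"
  proof (rule order_tendstoI)
    fix e :: real assume "0 < e"
    \<comment> \<open>Below the height \<open>f z\<close> the inverse stays below \<open>z\<close>,
      hence below \<open>e\<close>; the minimum with \<open>u\<close> keeps \<open>z\<close> in the
      domain.\<close>
    define z where "z = min e u"
    have z: "0 < z" "z \<le> u" "z \<le> e" using \<open>0 < e\<close> u by (auto simp: z_def)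
    have fz: "0 < f z" using less[of 0 z] z f0 by simp
    have "g h < e" if h: "0 < h" "h < f z" for h
    proof -
      have "f z \<le> f u" using less[of z u] z by (cases "z = u") auto
      then have "0 < g h" "g h < u" "f (g h) = h" using inv[of h] h by auto
      then have "\<not> z < g h" "z \<noteq> g h" using less[of z "g h"] h z by auto
      then show ?thesis using z by simp
    qed
    then show "eventually (\<lambda>h. g h < e) (at_right 0)"
      using fz by (auto simp: eventually_at_right_field)
  next
    fix e :: real assume "e < 0"
    have fu: "0 < f u" using less[of 0 u] u f0 by simp
    have "e < g h" if h: "0 < h" "h < f u" for h
      using inv[OF h] \<open>e < 0\<close> by auto
    then show "eventually (\<lambda>h. e < g h) (at_right 0)"
      using fu by (auto simp: eventually_at_right_field)
  qed
qed

locale exponents =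
  fixes p q :: real
  assumes pq: "p < q"
begin

text \<open>
  Here \<open>energy\<close> is the function \<open>A\<close> of the introduction, in closed form. The two logarithms
  coalesce for \<open>p = 0\<close>, and one of them disappears for \<open>q = 0\<close>.
\<close>

definition "admissible z \<longleftrightarrow> - 1 < z \<and> 0 < q * z + (q - p)"

definition "Q z = (1 + z) * (q * z + (q - p))"

definition "energy z =
  (if p \<noteq> 0 \<and> q \<noteq> 0 then ln (1 + z) / p - (q - p) / (p * q) * ln (1 + q * z / (q - p))
   else if p = 0 then (ln (1 + z) + 1 / (1 + z) - 1) / q
   else (z - ln (1 + z)) / (q - p))"

lemma admissible_0: "admissible 0"
  using pq by (simp add: admissible_def)

lemma admissible_between: "admissible x \<Longrightarrow> admissible y \<Longrightarrow> x \<le> z \<Longrightarrow> z \<le> y \<Longrightarrow> admissible z"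
  unfolding admissible_def
  by (smt (verit) mult_left_mono mult_left_mono_neg)

lemma Q_pos: "admissible z \<Longrightarrow> 0 < Q z"
  by (auto simp: admissible_def Q_def)

lemma energy_0: "energy 0 = 0"
  by (simp add: energy_def)

lemma energy':
  assumes "admissible z"
  shows "(energy has_real_derivative z / Q z) (at z)"
proof -
  have z: "0 < 1 + z" "0 < q * z + (q - p)" using assms by (auto simp: admissible_def)
  consider "p \<noteq> 0" "q \<noteq> 0" | "p = 0" | "q = 0" "p \<noteq> 0" by auto
  then show ?thesis
  proof cases
    case 1
    have eq: "1 + q * z / (q - p) = (q * z + (q - p)) / (q - p)" using pq by (simp add: field_simps)
    have pos: "0 < 1 + q * z / (q - p)" unfolding eq using z pq by simp
    have "(energy has_real_derivative (1 / (1 + z)) / p - (q - p) / (p * q) * ((q / (q - p)) / (1 + q * z / (q - p)))) (at z)"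
      unfolding energy_def using 1 z pos by (auto intro!: derivative_eq_intros)
    moreover have "(1 / (1 + z)) / p - (q - p) / (p * q) * ((q / (q - p)) / (1 + q * z / (q - p)))
        = 1 / (p * (1 + z)) - (q - p) / (p * (q * z + (q - p)))"
      unfolding eq using 1 z pq by simp
    \<comment> \<open>This is the partial fraction decomposition; the two zeros of \<open>Q\<close>
      are distinct because \<open>p\<close> is not 0.\<close>
    moreover have "\<dots> = z / Q z"
      unfolding Q_def using 1 z by (simp add: divide_simps) (simp add: algebra_simps)
    ultimately show ?thesis by simp
  next
    case 2
    have "(energy has_real_derivative (1 / (1 + z) - 1 / (1 + z)\<^sup>2) / q) (at z)"
      unfolding energy_def using 2 z pq
      by (auto intro!: derivative_eq_intros simp: power2_eq_square)
    moreover have "(1 / (1 + z) - 1 / (1 + z)\<^sup>2) / q = z / Q z"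
      unfolding Q_def using 2 z pq by (simp add: divide_simps power2_eq_square) (simp add: algebra_simps)
    ultimately show ?thesis by simp
  next
    case 3
    have "(energy has_real_derivative (1 - 1 / (1 + z)) / (q - p)) (at z)"
      unfolding energy_def using 3 z pq
      by (auto intro!: derivative_eq_intros)
    moreover have "(1 - 1 / (1 + z)) / (q - p) = z / Q z"
      unfolding Q_def using 3 z pq by (simp add: divide_simps)
    ultimately show ?thesis by simp
  qed
qed

lemma energy_strict_mono:
  assumes "admissible y" "admissible z" "0 \<le> y" "y < z"
  shows "energy y < energy z"
proof (rule DERIV_pos_imp_increasing_open[OF assms(4)])
  have d: "admissible w" if "y \<le> w" "w \<le> z" for w using admissible_between assms that by blast
  show "\<exists>d. (energy has_real_derivative d) (at w) \<and> 0 < d" if "y < w" "w < z" for w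
    using energy'[OF d] Q_pos[OF d] that assms by (intro exI[of _ "w / Q w"]) auto
  show "continuous_on {y..z} energy"
    using d by (intro DERIV_continuous_on[where D = "\<lambda>w. w / Q w"])
      (auto intro!: has_field_derivative_at_within energy')
qed

lemma energy_strict_antimono:
  assumes "admissible y" "admissible z" "y < z" "z \<le> 0"
  shows "energy z < energy y"
proof (rule DERIV_neg_imp_decreasing_open[OF assms(3)])
  have d: "admissible w" if "y \<le> w" "w \<le> z" for w using admissible_between assms that by blast
  show "\<exists>d. (energy has_real_derivative d) (at w) \<and> d < 0" if "y < w" "w < z" for w
    using energy'[OF d] Q_pos[OF d] that assms by (intro exI[of _ "w / Q w"]) (auto simp: divide_neg_pos)
  show "continuous_on {y..z} energy"
    using d by (intro DERIV_continuous_on[where D = "\<lambda>w. w / Q w"])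
      (auto intro!: has_field_derivative_at_within energy')
qed

text \<open>These are \<open>\<zeta>\<^sub>+\<close> and \<open>\<zeta>\<^sub>-\<close> of the
  introduction. The descriptions are meaningful only at heights that the energy attains on the
  respective side of 0.\<close>

definition "right_branch h = (THE z. 0 \<le> z \<and> admissible z \<and> energy z = h)"
definition "left_branch h = (THE z. z \<le> 0 \<and> admissible z \<and> energy z = h)"

lemma right_branch_energy: "admissible z \<Longrightarrow> 0 \<le> z \<Longrightarrow> right_branch (energy z) = z"
  unfolding right_branch_def using energy_strict_mono
  by (intro the_equality) (metis, metis less_irrefl linorder_neqE)

lemma left_branch_energy: "admissible z \<Longrightarrow> z \<le> 0 \<Longrightarrow> left_branch (energy z) = z"
  unfolding left_branch_def using energy_strict_antimono
  by (intro the_equality) (metis, metis less_irrefl linorder_neqE)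

text \<open>The sum \<open>weight\<close> is \<open>J\<close>. It is kept in two parts because each
  side of the zero of \<zeta> contributes one of them to the period.\<close>

definition "weight_right h = sqrt (1 - exp (- (2 * h))) / right_branch h"
definition "weight_left h = - sqrt (1 - exp (- (2 * h))) / left_branch h"
definition "weight h = weight_right h + weight_left h"

text \<open>Along a branch \<open>t = 1 / z\<close> satisfies
  \<open>t' = - t * (t + 1) * ((q - p) * t + q)\<close>. The shift removes the quadratic term and
  the scale gives the cubic term the coefficient 1/2. The linear and constant coefficients are
  \<open>c\<close> and \<open>D\<close> of the introduction.\<close>

definition "root_scale = sqrt (2 * (q - p))"
definition "root_shift = (2 * q - p) / (3 * (q - p))"
definition "lin_coeff = 3 * (q - p) * root_shift\<^sup>2 - q"
definition "const_coeff = root_scale * (root_shift * (1 - root_shift) * (q - (q - p) * root_shift))"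

lemma cubic_normal_form:
  "(root_scale * (t + root_shift)) ^ 3 / 2 - lin_coeff * (root_scale * (t + root_shift)) - const_coeff = root_scale * (t * (t + 1) * ((q - p) * t + q))"
proof -
  define k a b where "k = root_scale" and "a = q - p" and "b = root_shift"
  have k: "k\<^sup>2 = 2 * a" unfolding k_def a_def root_scale_def using pq by simp
  have b: "3 * a * b = a + q" unfolding a_def b_def root_shift_def using pq by simp
  have "(k * (t + b)) ^ 3 / 2 = k * k\<^sup>2 * (t + b) ^ 3 / 2"
    by (simp add: power_mult_distrib power2_eq_square power3_eq_cube)
  also have "\<dots> = k * (a * (t + b) ^ 3)" unfolding k by simp
  finally have 1: "(k * (t + b)) ^ 3 / 2 = k * (a * (t + b) ^ 3)" .
  have q: "q = 3 * a * b - a" using b by simp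
  have 2: "a * (t + b) ^ 3 - (3 * a * b\<^sup>2 - q) * (t + b) - b * (1 - b) * (q - a * b) = t * (t + 1) * (a * t + q)"
    unfolding q by (simp add: algebra_simps power2_eq_square power3_eq_cube)
  have "(k * (t + b)) ^ 3 / 2 - (3 * a * b\<^sup>2 - q) * (k * (t + b)) - k * (b * (1 - b) * (q - a * b))
     = k * (t * (t + 1) * (a * t + q))"
    unfolding 1 2[symmetric] by (simp add: algebra_simps)
  then show ?thesis
    unfolding lin_coeff_def const_coeff_def k_def a_def b_def .
qed

lemma cubic_at_recip:
  assumes "z \<noteq> 0"
  shows "(1 / z) * (1 / z + 1) * ((q - p) * (1 / z) + q) = Q z / z ^ 3"
  unfolding Q_def using assms by (simp add: field_simps power3_eq_cube)

section \<open>Signs of the shifted reciprocals and meaning of the coefficients\<close>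

lemma root_scale_pos: "0 < root_scale"
  using pq by (simp add: root_scale_def)

lemma root_shift: "3 * (q - p) * root_shift = 2 * q - p"
  using pq by (simp add: root_shift_def)

lemma recip_root_shift: "z \<noteq> 0 \<Longrightarrow> 1 / z + root_shift = (3 * (q - p) + (2 * q - p) * z) / (3 * (q - p) * z)"
  unfolding root_shift[symmetric] using pq by (simp add: field_simps)

text \<open>The expression is the sum of \<open>q * z + (q - p)\<close>,
  \<open>(q - p) * (1 + z)\<close> and \<open>q - p\<close>. As a consequence the shifted reciprocal
  has the sign of \<open>z\<close>.\<close>

lemma recip_numerator_pos:
  assumes "admissible z"
  shows "0 < 3 * (q - p) + (2 * q - p) * z"
proof -
  have "0 < (q - p) * (1 + z)" "0 < q * z + (q - p)" using assms pq by (auto simp: admissible_def)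
  moreover have "3 * (q - p) + (2 * q - p) * z = (q * z + (q - p)) + (q - p) * (1 + z) + (q - p)"
    by (simp add: algebra_simps)
  ultimately show ?thesis using pq by linarith
qed

lemma recip_root_shift_pos: "admissible z \<Longrightarrow> 0 < z \<Longrightarrow> 0 < 1 / z + root_shift"
  using recip_root_shift[of z] recip_numerator_pos[of z] pq by simp

lemma recip_root_shift_neg: "admissible z \<Longrightarrow> z < 0 \<Longrightarrow> 1 / z + root_shift < 0"
  using recip_root_shift[of z] recip_numerator_pos[of z] pq by (simp add: divide_pos_neg mult_pos_neg)

text \<open>Multiplying \<open>lin_coeff - 1\<close> by the positive number
  \<open>3 * (q - p)\<close> yields exactly the quadratic expression.\<close>

lemma lin_coeff_le_1_iff: "lin_coeff \<le> 1 \<longleftrightarrow> p\<^sup>2 - p * q + q\<^sup>2 + 3 * p - 3 * q \<le> 0"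
proof -
  have "3 * (q - p) * (lin_coeff - 1) = (3 * (q - p) * root_shift)\<^sup>2 - 3 * (q - p) * q - 3 * (q - p)"
    unfolding lin_coeff_def by (simp add: algebra_simps power2_eq_square)
  also have "\<dots> = p\<^sup>2 - p * q + q\<^sup>2 + 3 * p - 3 * q"
    unfolding root_shift by (simp add: algebra_simps power2_eq_square)
  finally have "3 * (q - p) * (lin_coeff - 1) = p\<^sup>2 - p * q + q\<^sup>2 + 3 * p - 3 * q" .
  moreover have "3 * (q - p) * (lin_coeff - 1) \<le> 0 \<longleftrightarrow> lin_coeff - 1 \<le> 0"
    using pq by (simp add: mult_le_0_iff)
  ultimately show ?thesis by simp
qed

text \<open>If \<open>const_coeff\<close> vanishes, one of the roots 0, \<open>- 1\<close>,
  \<open>- q / (q - p)\<close> of the cubic in \<open>t\<close> lies at the centre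
  \<open>- root_shift\<close>. Each choice makes \<open>p\<close> and \<open>q\<close> proportional,
  and \<open>lin_coeff = 1\<close> then leaves one pair besides \<open>p = q = 0\<close>.\<close>

lemma exceptional:
  assumes c: "lin_coeff = 1" and d: "const_coeff = 0"
  shows "(p, q) \<in> {(1, 2), (- 2, - 1), (- 2, 2)}"
proof -
  have "(3 * (q - p) * root_shift)\<^sup>2 = 3 * (q - p) * (lin_coeff + q)"
    unfolding lin_coeff_def by (simp add: algebra_simps power2_eq_square)
  then have e: "(2 * q - p)\<^sup>2 = 3 * (q - p) * (q + 1)"
    unfolding root_shift c by (simp add: add.commute)
  consider "root_shift = 0" | "root_shift = 1" | "q = (q - p) * root_shift"
    using d root_scale_pos by (auto simp: const_coeff_def)
  then show ?thesis
  proof cases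
    case 1
    then have p: "p = 2 * q" using root_shift by simp
    have "0 = - 3 * q * (q + 1)" using e unfolding p by simp
    then have "q = - 1" using pq p by auto
    then show ?thesis using p by simp
  next
    case 2
    then have q: "q = 2 * p" using root_shift by simp
    have "3 * p * (p - 1) = 0" using e unfolding q by (simp add: power2_eq_square algebra_simps)
    then have "p = 1" using pq q by auto
    then show ?thesis using q by simp
  next
    case 3
    moreover have "3 * ((q - p) * root_shift) = 2 * q - p" using root_shift by (simp only: mult.assoc)
    ultimately have p: "p = - q" by simp
    have "q * (q - 2) = 0" using e unfolding p by (simp add: power2_eq_square algebra_simps)
    then have "q = 2" using pq p by auto
    then show ?thesis using p by simp
  qed
qed

end

text \<open>In the application \<open>u\<close> and \<open>v\<close> are the values of \<zeta> at 1
  and \<open>r\<close>. Positive heights below their common energy are attained once on each side of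
  0 between \<open>v\<close> and \<open>u\<close>.\<close>

locale level = exponents +
  fixes u v :: real
  assumes uv: "0 < u" "v < 0" "admissible u" "admissible v" "energy u = energy v"
begin

definition "H = energy u"

lemma H_pos: "0 < H"
  unfolding H_def using energy_strict_mono[of 0 u] uv admissible_0 by (simp add: energy_0)

lemma right_branch_props:
  shows "0 < h \<Longrightarrow> h < H \<Longrightarrow> 0 < right_branch h \<and> right_branch h < u \<and> energy (right_branch h) = h"
    and "0 < h \<Longrightarrow> h < H \<Longrightarrow> (right_branch has_real_derivative Q (right_branch h) / right_branch h) (at h)"
    and "(right_branch \<longlongrightarrow> 0) (at_right 0)"
proof -
  have d: "admissible z" if "0 \<le> z" "z \<le> u" for z using admissible_between[OF admissible_0 uv(3)] that by blast
  note * = inverse_branch[of u energy "\<lambda>z. z / Q z" right_branch]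
  show "0 < h \<Longrightarrow> h < H \<Longrightarrow> 0 < right_branch h \<and> right_branch h < u \<and> energy (right_branch h) = h"
    using *(1)[of h] uv d energy' Q_pos by (auto simp: right_branch_energy energy_0 H_def)
  show "0 < h \<Longrightarrow> h < H \<Longrightarrow> (right_branch has_real_derivative Q (right_branch h) / right_branch h) (at h)"
    using *(2)[of h] uv d energy' Q_pos by (auto simp: right_branch_energy energy_0 H_def)
  show "(right_branch \<longlongrightarrow> 0) (at_right 0)"
    using *(3) uv d energy' Q_pos by (auto simp: right_branch_energy energy_0)
qed

text \<open>The reflection of \<open>z\<close> to \<open>- z\<close> reduces this side to
  \<open>inverse_branch\<close>.\<close>

lemma left_branch_props:
  shows "0 < h \<Longrightarrow> h < H \<Longrightarrow> left_branch h < 0 \<and> v < left_branch h \<and> energy (left_branch h) = h"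
    and "0 < h \<Longrightarrow> h < H \<Longrightarrow> (left_branch has_real_derivative Q (left_branch h) / left_branch h) (at h)"
    and "(left_branch \<longlongrightarrow> 0) (at_right 0)"
proof -
  have d: "admissible (- z)" if "0 \<le> z" "z \<le> - v" for z using admissible_between[OF uv(4) admissible_0] that by auto
  have der: "((\<lambda>z. energy (- z)) has_real_derivative z / Q (- z)) (at z)" if "0 \<le> z" "z \<le> - v" for z
  proof -
    have "((\<lambda>z. energy (- z)) has_real_derivative (- z / Q (- z)) * (- 1)) (at z)"
      by (rule DERIV_chain2[where f = energy and g = uminus and x = z])
         (use energy'[OF d[OF that]] DERIV_minus[OF DERIV_ident, of z UNIV] in auto)
    then show ?thesis by simp
  qed
  note * = inverse_branch[of "- v" "\<lambda>z. energy (- z)" "\<lambda>z. z / Q (- z)" "\<lambda>h. - left_branch h"]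
  have inv: "- left_branch (energy (- z)) = z" if "0 \<le> z" "z \<le> - v" for z
    using left_branch_energy[OF d[OF that]] that by simp
  have H: "H = energy (- (- v))" using uv by (simp add: H_def)
  have pos: "0 < z / Q (- z)" if "0 < z" "z \<le> - v" for z using Q_pos d that by simp
  have v: "0 < - v" "energy (- 0) = 0" using uv energy_0 by auto
  show "0 < h \<Longrightarrow> h < H \<Longrightarrow> left_branch h < 0 \<and> v < left_branch h \<and> energy (left_branch h) = h"
    using *(1)[OF v der pos inv, of h] H by auto
  show "0 < h \<Longrightarrow> h < H \<Longrightarrow> (left_branch has_real_derivative Q (left_branch h) / left_branch h) (at h)"
    using DERIV_minus[OF *(2)[OF v der pos inv, of h]] H by auto
  show "(left_branch \<longlongrightarrow> 0) (at_right 0)"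
    using tendsto_minus[OF *(3)[OF v der pos inv]] by simp
qed

lemma admissible_right_branch: "0 < h \<Longrightarrow> h < H \<Longrightarrow> admissible (right_branch h)"
  using right_branch_props(1)[of h] admissible_between[OF admissible_0 uv(3)] by auto

lemma admissible_left_branch: "0 < h \<Longrightarrow> h < H \<Longrightarrow> admissible (left_branch h)"
  using left_branch_props(1)[of h] admissible_between[OF uv(4) admissible_0] by auto

text \<open>The sign on the left makes both functions positive. They are \<open>s\<close> and
  \<open>n\<close> of the introduction if \<open>const_coeff\<close> is nonnegative, and exchange
  roles otherwise.\<close>

definition "right_root h = root_scale * (1 / right_branch h + root_shift)"
definition "left_root h = - root_scale * (1 / left_branch h + root_shift)"

lemma right_root':
  assumes h: "0 < h" "h < H"
  shows "(right_root has_real_derivative - (right_root h ^ 3 / 2 - lin_coeff * right_root h - const_coeff)) (at h)"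
proof -
  have z: "0 < right_branch h" using right_branch_props(1)[OF h] by simp
  have "(right_root has_real_derivative root_scale * (- (Q (right_branch h) / right_branch h) / (right_branch h)\<^sup>2)) (at h)"
    unfolding right_root_def using right_branch_props(2)[OF h] z
    by (auto intro!: derivative_eq_intros simp: power2_eq_square)
  moreover have "root_scale * (- (Q (right_branch h) / right_branch h) / (right_branch h)\<^sup>2) = - (root_scale * (Q (right_branch h) / right_branch h ^ 3))"
    by (simp add: power2_eq_square power3_eq_cube)
  ultimately show ?thesis
    unfolding right_root_def[of h] cubic_normal_form cubic_at_recip[OF less_imp_neq[OF z, symmetric]] by (simp only:)
qed

lemma left_root':
  assumes h: "0 < h" "h < H"
  shows "(left_root has_real_derivative - (left_root h ^ 3 / 2 - lin_coeff * left_root h + const_coeff)) (at h)"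
proof -
  have z: "left_branch h < 0" using left_branch_props(1)[OF h] by simp
  have "(left_root has_real_derivative - root_scale * (- (Q (left_branch h) / left_branch h) / (left_branch h)\<^sup>2)) (at h)"
    unfolding left_root_def using left_branch_props(2)[OF h] z
    by (auto intro!: derivative_eq_intros simp: power2_eq_square)
  moreover have "- root_scale * (- (Q (left_branch h) / left_branch h) / (left_branch h)\<^sup>2) = root_scale * (Q (left_branch h) / left_branch h ^ 3)"
    by (simp add: power2_eq_square power3_eq_cube)
  moreover have "- (left_root h ^ 3 / 2 - lin_coeff * left_root h + const_coeff)
      = (root_scale * (1 / left_branch h + root_shift)) ^ 3 / 2 - lin_coeff * (root_scale * (1 / left_branch h + root_shift)) - const_coeff"
    unfolding left_root_def by (simp add: power3_eq_cube)
  ultimately show ?thesis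
    unfolding cubic_normal_form cubic_at_recip[OF less_imp_neq[OF z]] by (simp only:)
qed

lemma right_root_pos: "0 < h \<Longrightarrow> h < H \<Longrightarrow> 0 < right_root h"
  unfolding right_root_def using recip_root_shift_pos admissible_right_branch right_branch_props(1) root_scale_pos by auto

lemma left_root_pos: "0 < h \<Longrightarrow> h < H \<Longrightarrow> 0 < left_root h"
  unfolding left_root_def using recip_root_shift_neg admissible_left_branch left_branch_props(1) root_scale_pos
  by (metis mult_minus_left mult_pos_neg neg_0_less_iff_less)

lemma right_root_cubic:
  assumes h: "0 < h" "h < H"
  shows "0 < right_root h ^ 3 / 2 - lin_coeff * right_root h - const_coeff"
proof -
  have z: "0 < right_branch h" using right_branch_props(1)[OF h] by simp
  show ?thesis
    unfolding right_root_def[of h] cubic_normal_form cubic_at_recip[OF less_imp_neq[OF z, symmetric]]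
    using z Q_pos[OF admissible_right_branch[OF h]] root_scale_pos by simp
qed

lemma left_root_cubic:
  assumes h: "0 < h" "h < H"
  shows "0 < left_root h ^ 3 / 2 - lin_coeff * left_root h + const_coeff"
proof -
  have z: "left_branch h < 0" using left_branch_props(1)[OF h] by simp
  have "- (left_root h ^ 3 / 2 - lin_coeff * left_root h + const_coeff)
      = (root_scale * (1 / left_branch h + root_shift)) ^ 3 / 2 - lin_coeff * (root_scale * (1 / left_branch h + root_shift)) - const_coeff"
    unfolding left_root_def by (simp add: power3_eq_cube)
  also have "\<dots> = root_scale * (Q (left_branch h) / left_branch h ^ 3)"
    unfolding cubic_normal_form cubic_at_recip[OF less_imp_neq[OF z]] ..
  also have "\<dots> < 0"
    using z Q_pos[OF admissible_left_branch[OF h]] root_scale_pos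
    by (intro mult_pos_neg divide_pos_neg) (auto simp: power_less_zero_eq)
  finally show ?thesis by simp
qed

lemma right_root_lim: "filterlim right_root at_top (at_right 0)"
proof -
  have "eventually (\<lambda>h. 0 < right_branch h) (at_right 0)"
    using right_branch_props(1) H_pos by (auto simp: eventually_at_right_field)
  then have "filterlim (\<lambda>h. inverse (right_branch h)) at_top (at_right 0)"
    by (rule filterlim_inverse_at_top[OF right_branch_props(3)])
  then have "filterlim (\<lambda>h. root_shift + inverse (right_branch h)) at_top (at_right 0)"
    by (rule filterlim_tendsto_add_at_top[OF tendsto_const])
  then have "filterlim (\<lambda>h. root_scale * (root_shift + inverse (right_branch h))) at_top (at_right 0)"
    by (rule filterlim_tendsto_pos_mult_at_top[OF tendsto_const root_scale_pos])
  then show ?thesis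
    unfolding right_root_def by (simp add: add.commute inverse_eq_divide)
qed

lemma left_root_lim: "filterlim left_root at_top (at_right 0)"
proof -
  have "eventually (\<lambda>h. 0 < - left_branch h) (at_right 0)"
    using left_branch_props(1) H_pos by (auto simp: eventually_at_right_field)
  then have "filterlim (\<lambda>h. inverse (- left_branch h)) at_top (at_right 0)"
    using tendsto_minus[OF left_branch_props(3)] by (intro filterlim_inverse_at_top) simp_all
  then have "filterlim (\<lambda>h. - root_shift + inverse (- left_branch h)) at_top (at_right 0)"
    by (rule filterlim_tendsto_add_at_top[OF tendsto_const])
  then have "filterlim (\<lambda>h. root_scale * (- root_shift + inverse (- left_branch h))) at_top (at_right 0)"
    by (rule filterlim_tendsto_pos_mult_at_top[OF tendsto_const root_scale_pos])
  moreover have "root_scale * (- root_shift + inverse (- left_branch h)) = left_root h" for h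
    unfolding left_root_def by (simp add: field_simps inverse_eq_divide)
  ultimately show ?thesis by simp
qed

lemma cubic_pair_D: "0 \<le> const_coeff \<Longrightarrow> cubic_pair right_root left_root lin_coeff const_coeff H"
  using right_root' left_root' right_root_pos left_root_pos right_root_cubic left_root_cubic right_root_lim left_root_lim H_pos
  by unfold_locales auto

text \<open>Replacing \<open>y\<close> by \<open>- y\<close> in the cubic equation changes only the
  sign of the constant, so exchanging the branches restores the normalisation.\<close>

lemma cubic_pair_D': "const_coeff \<le> 0 \<Longrightarrow> cubic_pair left_root right_root lin_coeff (- const_coeff) H"
  using right_root' left_root' right_root_pos left_root_pos right_root_cubic left_root_cubic right_root_lim left_root_lim H_pos
  by unfold_locales auto

text \<open>The shifts cancel in the sum of the two roots, which leaves the scaled difference of the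
  reciprocals.\<close>

lemma weight_eq:
  assumes h: "0 < h" "h < H"
  shows "weight h = sqrt ((right_root h + left_root h)\<^sup>2 * (1 - exp (- (2 * h)))) / root_scale"
proof -
  have "0 < 1 / right_branch h" "1 / left_branch h < 0"
    using right_branch_props(1)[OF h] left_branch_props(1)[OF h] by auto
  then have "0 \<le> root_scale * (1 / right_branch h - 1 / left_branch h)"
    using root_scale_pos by (intro mult_nonneg_nonneg) linarith+
  moreover have "right_root h + left_root h = root_scale * (1 / right_branch h - 1 / left_branch h)"
    unfolding right_root_def left_root_def by (simp add: algebra_simps)
  ultimately have root: "sqrt ((right_root h + left_root h)\<^sup>2) = root_scale * (1 / right_branch h - 1 / left_branch h)"
    by simp
  define S where "S = sqrt (1 - exp (- (2 * h)))"
  have "weight h = (1 / right_branch h - 1 / left_branch h) * S"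
    unfolding weight_def weight_right_def weight_left_def S_def by (simp add: left_diff_distrib)
  also have "\<dots> = root_scale * (1 / right_branch h - 1 / left_branch h) * S / root_scale"
    using root_scale_pos by (simp only: mult.assoc nonzero_mult_div_cancel_left[OF less_imp_neq[symmetric]])
  finally show ?thesis
    unfolding real_sqrt_mult root S_def .
qed

lemma weight_strict_antimono:
  assumes "p\<^sup>2 - p * q + q\<^sup>2 + 3 * p - 3 * q \<le> 0" "(p, q) \<notin> {(1, 2), (- 2, - 1), (- 2, 2)}"
    and h: "0 < h" "h < h'" "h' < H"
  shows "weight h' < weight h"
proof -
  have c: "lin_coeff \<le> 1" using assms(1) lin_coeff_le_1_iff by simp
  have cD: "lin_coeff \<noteq> 1 \<or> const_coeff \<noteq> 0"
    using exceptional assms(2) by blast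
  have "(right_root h' + left_root h')\<^sup>2 * (1 - exp (- (2 * h'))) < (right_root h + left_root h)\<^sup>2 * (1 - exp (- (2 * h)))"
  proof (cases "0 \<le> const_coeff")
    case True
    then interpret cubic_pair right_root left_root lin_coeff const_coeff H by (rule cubic_pair_D)
    show ?thesis using profile_strict_antimono[OF c cD h] by (simp add: profile_def)
  next
    case False
    then interpret cubic_pair left_root right_root lin_coeff "- const_coeff" H by (intro cubic_pair_D') simp
    show ?thesis using profile_strict_antimono[OF c _ h] cD by (simp add: profile_def add.commute)
  qed
  then show ?thesis
    using h root_scale_pos by (simp add: weight_eq divide_strict_right_mono)
qed

lemma weight_mono_near_0:
  assumes "0 < p\<^sup>2 - p * q + q\<^sup>2 + 3 * p - 3 * q"
  obtains H' where "0 < H'" "H' \<le> H" "\<And>h h'. 0 < h \<Longrightarrow> h < h' \<Longrightarrow> h' < H' \<Longrightarrow> weight h \<le> weight h'"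
proof -
  have c: "1 < lin_coeff" using assms lin_coeff_le_1_iff by (simp add: not_le[symmetric])
  obtain H' where H': "0 < H'" "H' \<le> H" "\<And>h h'. 0 < h \<Longrightarrow> h < h' \<Longrightarrow> h' < H' \<Longrightarrow>
    (right_root h + left_root h)\<^sup>2 * (1 - exp (- (2 * h))) \<le> (right_root h' + left_root h')\<^sup>2 * (1 - exp (- (2 * h')))"
  proof (cases "0 \<le> const_coeff")
    case True
    then interpret cubic_pair right_root left_root lin_coeff const_coeff H by (rule cubic_pair_D)
    show ?thesis using profile_mono_near_0[OF c] that unfolding profile_def by metis
  next
    case False
    then interpret cubic_pair left_root right_root lin_coeff "- const_coeff" H by (intro cubic_pair_D') simp
    show ?thesis using profile_mono_near_0[OF c] that unfolding profile_def by (metis add.commute)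
  qed
  have "weight h \<le> weight h'" if "0 < h" "h < h'" "h' < H'" for h h'
    using H'(2) H'(3)[OF that] that root_scale_pos by (simp add: weight_eq divide_right_mono)
  then show ?thesis using that H' by blast
qed

end

section \<open>The period as an average over a quarter circle\<close>

text \<open>Strictness comes from the closed middle third, where the difference is continuous and
  positive; on the rest it is nonnegative. No continuity at the endpoints is available for the
  weights.\<close>

lemma integral_less_open:
  fixes f g :: "real \<Rightarrow> real"
  assumes ab: "a < b" and int: "f integrable_on {a<..<b}" "g integrable_on {a<..<b}"
    and cont: "continuous_on {a<..<b} f" "continuous_on {a<..<b} g"
    and less: "\<And>x. a < x \<Longrightarrow> x < b \<Longrightarrow> f x < g x"
  shows "integral {a<..<b} f < integral {a<..<b} g"
proof -
  define c d where "c = (2 * a + b) / 3" and "d = (a + 2 * b) / 3"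
  have cd: "a < c" "c < d" "d < b" using ab by (auto simp: c_def d_def)
  have cont': "continuous_on {c..d} (\<lambda>x. g x - f x)"
    by (intro continuous_intros continuous_on_subset[OF cont(1)] continuous_on_subset[OF cont(2)]) (use cd in auto)
  have diff: "(\<lambda>x. g x - f x) integrable_on {a<..<b}" using int by (intro integrable_diff)
  have "integral {c..d} (\<lambda>x. 0) < integral {c..d} (\<lambda>x. g x - f x)"
    by (rule integral_less_real[OF _ cont']) (use cd less in auto)
  also have "\<dots> \<le> integral {a<..<b} (\<lambda>x. g x - f x)"
    by (rule integral_subset_le[OF _ integrable_continuous_real[OF cont'] diff])
       (use cd less in \<open>auto simp: less_imp_le\<close>)
  finally show ?thesis using int by (simp add: integral_diff)
qed

lemma strict_mono_image_open:
  fixes f :: "real \<Rightarrow> real"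
  assumes "a < b" "continuous_on {a..b} f" "\<And>x y. a \<le> x \<Longrightarrow> x < y \<Longrightarrow> y \<le> b \<Longrightarrow> f x < f y"
  shows "f ` {a<..<b} = {f a<..<f b}"
proof
  show "f ` {a<..<b} \<subseteq> {f a<..<f b}" using assms(3) by (auto simp: less_imp_le)
  show "{f a<..<f b} \<subseteq> f ` {a<..<b}"
  proof
    fix y assume y: "y \<in> {f a<..<f b}"
    obtain x where x: "a \<le> x" "x \<le> b" "f x = y"
      using IVT'[of f a y b] assms(1,2) y by auto
    then have "x \<noteq> a" "x \<noteq> b" using y by auto
    then show "y \<in> f ` {a<..<b}" using x by (intro image_eqI[of _ _ x]) auto
  qed
qed

lemma strict_antimono_image_open:
  fixes f :: "real \<Rightarrow> real"
  assumes "a < b" "continuous_on {a..b} f" "\<And>x y. a \<le> x \<Longrightarrow> x < y \<Longrightarrow> y \<le> b \<Longrightarrow> f y < f x"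
  shows "f ` {a<..<b} = {f b<..<f a}"
proof -
  have "(\<lambda>x. - f x) ` {a<..<b} = {- f a<..<- f b}"
    using assms by (intro strict_mono_image_open continuous_on_minus) auto
  then have "uminus ` (\<lambda>x. - f x) ` {a<..<b} = uminus ` {- f a<..<- f b}" by simp
  then show ?thesis by (simp add: image_image)
qed

text \<open>The new variable is \<open>t = arcsin (sqrt (e x / E))\<close>, so
  \<open>e x = E * (sin t)\<^sup>2\<close>, and the factor before \<open>\<phi>\<close> is the
  absolute value of its derivative. The result depends on \<open>e\<close> only through
  \<open>E\<close>, which brings all periods to one fixed interval.\<close>

lemma beta_substitution:
  fixes e e' \<phi> :: "real \<Rightarrow> real"
  assumes E: "0 < E"
    and der: "\<And>x. a < x \<Longrightarrow> x < b \<Longrightarrow> (e has_real_derivative e' x) (at x)"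
    and inj: "inj_on e {a<..<b}" and img: "e ` {a<..<b} = {0<..<E}"
    and int: "(\<lambda>t. \<phi> (E * (sin t)\<^sup>2)) absolutely_integrable_on {0<..<pi / 2}"
  shows "(\<lambda>x. \<bar>e' x\<bar> / (2 * sqrt (e x) * sqrt (E - e x)) * \<phi> (e x)) absolutely_integrable_on {a<..<b}"
    and "integral {a<..<b} (\<lambda>x. \<bar>e' x\<bar> / (2 * sqrt (e x) * sqrt (E - e x)) * \<phi> (e x))
      = integral {0<..<pi / 2} (\<lambda>t. \<phi> (E * (sin t)\<^sup>2))"
proof -
  define g where "g x = arcsin (sqrt (e x / E))" for x
  define g' where "g' x = e' x / (2 * sqrt (e x) * sqrt (E - e x))" for x
  have e: "0 < e x" "e x < E" if "a < x" "x < b" for x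
  proof -
    have "e x \<in> {0<..<E}" unfolding img[symmetric] using that by (intro imageI) simp
    then show "0 < e x" "e x < E" by auto
  qed
  have sin_g: "E * (sin (g x))\<^sup>2 = e x" if "a < x" "x < b" for x
  proof -
    have "0 \<le> sqrt (e x / E)" "sqrt (e x / E) \<le> 1" using e[OF that] E by auto
    then have "sin (g x) = sqrt (e x / E)"
      unfolding g_def by (intro sin_arcsin) linarith+
    then show ?thesis using e[OF that] E by simp
  qed
  have der_g: "(g has_real_derivative g' x) (at x)" if x: "a < x" "x < b" for x
  proof -
    have pos: "0 < sqrt (e x)" "0 < sqrt (E - e x)" "0 < sqrt E" using e[OF x] E by auto
    have "0 < sqrt (e x / E)" "sqrt (e x / E) < 1"
      using e[OF x] E by auto
    then have "- 1 < sqrt (e x / E)" "sqrt (e x / E) < 1" by linarith+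
    then have "(g has_real_derivative inverse (sqrt (1 - (sqrt (e x / E))\<^sup>2)) * (inverse (sqrt (e x / E)) / 2 * (e' x / E))) (at x)"
      unfolding g_def using e[OF x] E der[OF x]
      by (intro DERIV_chain2[where f = arcsin] DERIV_arcsin DERIV_chain2[where f = sqrt] DERIV_real_sqrt DERIV_cdivide) auto
    moreover have "1 - (sqrt (e x / E))\<^sup>2 = (E - e x) / E"
      using e[OF x] E by (simp add: field_simps)
    then have "sqrt (1 - (sqrt (e x / E))\<^sup>2) = sqrt (E - e x) / sqrt E"
      by (simp add: real_sqrt_divide)
    moreover have "sqrt (e x / E) = sqrt (e x) / sqrt E"
      by (simp add: real_sqrt_divide)
    moreover have "inverse (sqrt (E - e x) / sqrt E) * (inverse (sqrt (e x) / sqrt E) / 2 * (e' x / E)) = g' x"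
    proof -
      have "inverse (sqrt (E - e x) / sqrt E) * (inverse (sqrt (e x) / sqrt E) / 2 * (e' x / E))
         = (sqrt E * sqrt E) * e' x / (2 * sqrt (e x) * sqrt (E - e x) * E)"
        using pos by (simp add: field_simps)
      also have "sqrt E * sqrt E = E" using E by simp
      finally show ?thesis using E by (simp add: g'_def)
    qed
    ultimately show ?thesis by simp
  qed
  have inj_g: "inj_on g {a<..<b}"
  proof (rule inj_onI)
    fix x y assume xy: "x \<in> {a<..<b}" "y \<in> {a<..<b}" "g x = g y"
    then have "e x = e y" using sin_g[of x] sin_g[of y] by simp
    then show "x = y" using inj_onD[OF inj] xy by blast
  qed
  have img_g: "g ` {a<..<b} = {0<..<pi / 2}"
  proof
    show "g ` {a<..<b} \<subseteq> {0<..<pi / 2}"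
    proof safe
      fix x assume x: "x \<in> {a<..<b}"
      then have "0 < sqrt (e x / E)" "sqrt (e x / E) < 1" using e[of x] E by auto
      then have "arcsin 0 < g x" "g x < arcsin 1"
        unfolding g_def by (intro arcsin_less_arcsin; linarith)+
      then show "g x \<in> {0<..<pi / 2}" by simp
    qed
    show "{0<..<pi / 2} \<subseteq> g ` {a<..<b}"
    proof
      fix t :: real assume t: "t \<in> {0<..<pi / 2}"
      then have s: "0 < sin t" "sin t < 1"
        using sin_gt_zero[of t] sin_monotone_2pi[of t "pi / 2"] by auto
      then have "(sin t)\<^sup>2 < 1" by (simp add: power_less_one_iff abs_square_less_1)
      then have "E * (sin t)\<^sup>2 \<in> {0<..<E}" using E s by auto
      then obtain x where x: "x \<in> {a<..<b}" "e x = E * (sin t)\<^sup>2" using img by (metis imageE)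
      have "sqrt (e x / E) = sin t" unfolding x(2) using E s by simp
      then have "g x = t" unfolding g_def using t by (simp add: arcsin_sin)
      then show "t \<in> g ` {a<..<b}" using x by auto
    qed
  qed
  let ?f = "\<lambda>t. \<phi> (E * (sin t)\<^sup>2)"
  have both: "(\<lambda>x. \<bar>g' x\<bar> * ?f (g x)) absolutely_integrable_on {a<..<b} \<and>
      integral {a<..<b} (\<lambda>x. \<bar>g' x\<bar> * ?f (g x)) = integral {0<..<pi / 2} ?f"
  proof (subst has_absolute_integral_change_of_variables_1'[where g = g])
    show "(g has_real_derivative g' x) (at x within {a<..<b})" if "x \<in> {a<..<b}" for x
      using der_g[of x] that by (simp add: has_field_derivative_at_within)
  qed (use inj_g int in \<open>simp_all add: img_g\<close>)
  have eq: "\<bar>g' x\<bar> * ?f (g x) = \<bar>e' x\<bar> / (2 * sqrt (e x) * sqrt (E - e x)) * \<phi> (e x)" if "x \<in> {a<..<b}" for x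
    using that e[of x] sin_g[of x] by (simp add: g'_def)
  have abs: "(\<lambda>x. \<bar>g' x\<bar> * ?f (g x)) absolutely_integrable_on {a<..<b}"
    and int: "integral {a<..<b} (\<lambda>x. \<bar>g' x\<bar> * ?f (g x)) = integral {0<..<pi / 2} ?f"
    using both by blast+
  show "(\<lambda>x. \<bar>e' x\<bar> / (2 * sqrt (e x) * sqrt (E - e x)) * \<phi> (e x)) absolutely_integrable_on {a<..<b}"
    using abs set_integrable_cong[OF refl refl eq] by (rule iffD1[rotated])
  show "integral {a<..<b} (\<lambda>x. \<bar>e' x\<bar> / (2 * sqrt (e x) * sqrt (E - e x)) * \<phi> (e x))
      = integral {0<..<pi / 2} ?f"
    using int integral_cong[OF eq] by (rule trans[OF sym, rotated])
qed

section \<open>The period as a function of the height\<close>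

context exponents begin

definition "sublevel h t = ln (1 + (exp (2 * h) - 1) * (sin t)\<^sup>2) / 2"

text \<open>The range of integration does not depend on \<open>h\<close>, and
  \<open>sublevel h t\<close> increases with positive \<open>h\<close>, so the monotonicity of
  \<open>weight\<close> carries over pointwise.\<close>

definition "period_at h = integral {0<..<pi / 2} (\<lambda>t. weight (sublevel h t))"

lemma sublevel_bounds:
  assumes "0 < h" "0 < t" "t < pi / 2"
  shows "0 < sublevel h t" "sublevel h t < h"
proof -
  have s: "0 < sin t" "sin t < 1"
    using assms sin_gt_zero[of t] sin_monotone_2pi[of t "pi / 2"] by auto
  then have s2: "0 < (sin t)\<^sup>2" "(sin t)\<^sup>2 < 1" by (auto simp: abs_square_less_1)
  define w where "w = (exp (2 * h) - 1) * (sin t)\<^sup>2"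
  have E: "0 < exp (2 * h) - 1" using assms by simp
  have w: "0 < w" "w < exp (2 * h) - 1"
    using mult_pos_pos[OF E s2(1)] mult_strict_left_mono[OF s2(2) E] by (auto simp: w_def)
  show "0 < sublevel h t" using w by (simp add: sublevel_def w_def[symmetric])
  have "ln (1 + w) < ln (exp (2 * h))" using w by (intro ln_less_cancel_iff[THEN iffD2]) linarith+
  then show "sublevel h t < h" by (simp add: sublevel_def w_def)
qed

lemma sublevel_less:
  assumes "0 < h" "h < h'" "0 < t" "t < pi / 2"
  shows "sublevel h t < sublevel h' t"
proof -
  have s2: "0 < (sin t)\<^sup>2" using assms sin_gt_zero[of t] by auto
  define w w' where "w = (exp (2 * h) - 1) * (sin t)\<^sup>2" and "w' = (exp (2 * h') - 1) * (sin t)\<^sup>2"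
  have "exp (2 * h) - 1 < exp (2 * h') - 1" using assms by simp
  then have "w < w'" unfolding w_def w'_def by (rule mult_strict_right_mono[OF _ s2])
  moreover have "0 < w" using s2 assms by (simp add: w_def)
  ultimately show ?thesis
    unfolding sublevel_def w_def[symmetric] w'_def[symmetric] by simp
qed

lemma continuous_on_sublevel:
  assumes "0 < h"
  shows "continuous_on {0<..<pi / 2} (sublevel h)"
proof -
  have "1 + (exp (2 * h) - 1) * (sin t)\<^sup>2 \<noteq> 0" for t
  proof -
    have "0 \<le> (exp (2 * h) - 1) * (sin t)\<^sup>2" using assms by (intro mult_nonneg_nonneg) auto
    then show ?thesis by linarith
  qed
  then show ?thesis
    unfolding sublevel_def by (intro continuous_intros) auto
qed

end

context level begin

text \<open>
  The quadratic bound keeps the two weights bounded near height 0, where both branches tend to 0.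
\<close>

lemma energy_le_square:
  obtains m where "0 < m" "\<And>z. v \<le> z \<Longrightarrow> z \<le> u \<Longrightarrow> 2 * energy z \<le> z\<^sup>2 / m"
proof -
  have admissible: "admissible z" if "v \<le> z" "z \<le> u" for z using admissible_between uv that by blast
  have "continuous_on {v..u} Q" unfolding Q_def by (intro continuous_intros)
  then obtain w where w: "w \<in> {v..u}" "\<And>z. z \<in> {v..u} \<Longrightarrow> Q w \<le> Q z"
    using continuous_attains_inf[of "{v..u}" Q] uv by auto
  have Qw: "0 < Q w" using Q_pos admissible w by auto
  \<comment> \<open>With \<open>Q w\<close> the minimum of \<open>Q\<close>, the derivative of this
    function has the sign of \<open>z\<close> or vanishes, so its least value is 0, taken at
    0.\<close>
  let ?f = "\<lambda>z. z\<^sup>2 / Q w - 2 * energy z"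
  have der: "(?f has_real_derivative 2 * z * (1 / Q w - 1 / Q z)) (at z)" if "v \<le> z" "z \<le> u" for z
    using energy'[OF admissible[OF that]] Qw by (auto intro!: derivative_eq_intros simp: field_simps)
  have Q: "0 \<le> 1 / Q w - 1 / Q z" if "v \<le> z" "z \<le> u" for z
    using w(2)[of z] Qw Q_pos[OF admissible[OF that]] that by (simp add: frac_le)
  have "0 \<le> ?f z" if z: "v \<le> z" "z \<le> u" for z
  proof (cases "0 \<le> z")
    case True
    have "?f 0 \<le> ?f z"
    proof (rule DERIV_nonneg_imp_nondecreasing[OF True])
      fix y assume "0 \<le> y" "y \<le> z"
      then show "\<exists>d. (?f has_real_derivative d) (at y) \<and> 0 \<le> d"
        using der[of y] Q[of y] z uv by (intro exI[of _ "2 * y * (1 / Q w - 1 / Q y)"]) auto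
    qed
    then show ?thesis by (simp add: energy_0)
  next
    case False
    have "?f 0 \<le> ?f z"
    proof (rule DERIV_nonpos_imp_nonincreasing[of z 0 ?f])
      fix y assume "z \<le> y" "y \<le> 0"
      then show "\<exists>d. (?f has_real_derivative d) (at y) \<and> d \<le> 0"
        using der[of y] Q[of y] z uv by (intro exI[of _ "2 * y * (1 / Q w - 1 / Q y)"]) (auto intro: mult_nonpos_nonneg)
    qed (use False in simp)
    then show ?thesis by (simp add: energy_0)
  qed
  then show ?thesis using that[OF Qw] by simp
qed

lemma sqrt_exp_le:
  assumes "0 < m" "2 * h \<le> z\<^sup>2 / m"
  shows "sqrt (1 - exp (- (2 * h))) \<le> \<bar>z\<bar> / sqrt m"
proof -
  have "1 - exp (- (2 * h)) \<le> 2 * h" using exp_ge_add_one_self[of "- (2 * h)"] by simp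
  then have "sqrt (1 - exp (- (2 * h))) \<le> sqrt (z\<^sup>2 / m)" using assms by simp
  then show ?thesis by (simp add: real_sqrt_divide)
qed

lemma weight_bounded:
  obtains B where "\<And>h. 0 < h \<Longrightarrow> h < H \<Longrightarrow> \<bar>weight_right h\<bar> \<le> B \<and> \<bar>weight_left h\<bar> \<le> B"
proof -
  obtain m where m: "0 < m" "\<And>z. v \<le> z \<Longrightarrow> z \<le> u \<Longrightarrow> 2 * energy z \<le> z\<^sup>2 / m"
    using energy_le_square by blast
  have "\<bar>weight_right h\<bar> \<le> 1 / sqrt m \<and> \<bar>weight_left h\<bar> \<le> 1 / sqrt m" if h: "0 < h" "h < H" for h
  proof -
    note right_branch = right_branch_props(1)[OF h] and left_branch = left_branch_props(1)[OF h]
    have "sqrt (1 - exp (- (2 * h))) \<le> \<bar>right_branch h\<bar> / sqrt m"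
      using sqrt_exp_le[OF m(1), of h "right_branch h"] m(2)[of "right_branch h"] right_branch uv by auto
    moreover have "sqrt (1 - exp (- (2 * h))) \<le> \<bar>left_branch h\<bar> / sqrt m"
      using sqrt_exp_le[OF m(1), of h "left_branch h"] m(2)[of "left_branch h"] left_branch uv by auto
    moreover have "0 \<le> sqrt (1 - exp (- (2 * h)))" using h by simp
    moreover have quot: "\<bar>S\<bar> / \<bar>z\<bar> \<le> 1 / sqrt m" if "0 \<le> S" "S \<le> \<bar>z\<bar> / sqrt m" "z \<noteq> 0" for S z :: real
      using divide_right_mono[OF that(2), of "\<bar>z\<bar>"] that by simp
    ultimately show ?thesis
      unfolding weight_right_def weight_left_def abs_divide abs_minus_cancel using right_branch left_branch by (intro conjI quot) auto
  qed
  then show ?thesis using that by blast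
qed

lemma continuous_on_weight_right: "continuous_on {0<..<H} weight_right" and continuous_on_weight_left: "continuous_on {0<..<H} weight_left"
proof -
  have "continuous_on {0<..<H} right_branch" "continuous_on {0<..<H} left_branch"
    using right_branch_props(2) left_branch_props(2)
    by (auto intro!: continuous_at_imp_continuous_on DERIV_isCont)
  moreover have "\<forall>h\<in>{0<..<H}. right_branch h \<noteq> 0 \<and> left_branch h \<noteq> 0"
    using right_branch_props(1) left_branch_props(1) by (metis greaterThanLessThan_iff less_irrefl)
  ultimately show "continuous_on {0<..<H} weight_right" "continuous_on {0<..<H} weight_left"
    unfolding weight_right_def weight_left_def by (auto intro!: continuous_intros)
qed

text \<open>The top height \<open>H\<close> is allowed, as the period requires, because
  \<open>sublevel h t\<close> stays strictly below \<open>h\<close> for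
  \<open>t < pi / 2\<close>.\<close>

lemma absolutely_integrable_sublevel:
  fixes f :: "real \<Rightarrow> real"
  assumes cont: "continuous_on {0<..<H} f" and bound: "\<And>h. 0 < h \<Longrightarrow> h < H \<Longrightarrow> \<bar>f h\<bar> \<le> B"
    and h: "0 < h" "h \<le> H"
  shows "continuous_on {0<..<pi / 2} (\<lambda>t. f (sublevel h t))"
    and "(\<lambda>t. f (sublevel h t)) absolutely_integrable_on {0<..<pi / 2}"
proof -
  have "sublevel h ` {0<..<pi / 2} \<subseteq> {0<..<H}"
    using sublevel_bounds[OF h(1)] h(2) by force
  then show c: "continuous_on {0<..<pi / 2} (\<lambda>t. f (sublevel h t))"
    using continuous_on_compose2[OF cont continuous_on_sublevel[OF h(1)]] by simp
  show "(\<lambda>t. f (sublevel h t)) absolutely_integrable_on {0<..<pi / 2}"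
  proof (rule measurable_bounded_by_integrable_imp_absolutely_integrable)
    show "(\<lambda>t. f (sublevel h t)) \<in> borel_measurable (lebesgue_on {0<..<pi / 2})"
      by (rule continuous_imp_measurable_on_sets_lebesgue[OF c]) simp
    show "(\<lambda>t. B) integrable_on {0<..<pi / 2}"
      using integrable_on_const[of "{0<..<pi / 2}"] by (simp add: lmeasurable_box)
    show "norm (f (sublevel h t)) \<le> B" if "t \<in> {0<..<pi / 2}" for t
      using bound[of "sublevel h t"] sublevel_bounds[OF h(1), of t] h(2) that by simp
  qed simp
qed

lemma weight_sublevel:
  assumes h: "0 < h" "h \<le> H"
  shows "(\<lambda>t. weight_right (sublevel h t)) absolutely_integrable_on {0<..<pi / 2}"
    and "(\<lambda>t. weight_left (sublevel h t)) absolutely_integrable_on {0<..<pi / 2}"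
    and "(\<lambda>t. weight (sublevel h t)) integrable_on {0<..<pi / 2}"
    and "continuous_on {0<..<pi / 2} (\<lambda>t. weight (sublevel h t))"
    and "period_at h = integral {0<..<pi / 2} (\<lambda>t. weight_right (sublevel h t)) + integral {0<..<pi / 2} (\<lambda>t. weight_left (sublevel h t))"
proof -
  obtain B where B: "\<And>h. 0 < h \<Longrightarrow> h < H \<Longrightarrow> \<bar>weight_right h\<bar> \<le> B \<and> \<bar>weight_left h\<bar> \<le> B"
    using weight_bounded by blast
  note p = absolutely_integrable_sublevel[OF continuous_on_weight_right _ h, of B]
  note n = absolutely_integrable_sublevel[OF continuous_on_weight_left _ h, of B]
  show pi: "(\<lambda>t. weight_right (sublevel h t)) absolutely_integrable_on {0<..<pi / 2}"
    and ni: "(\<lambda>t. weight_left (sublevel h t)) absolutely_integrable_on {0<..<pi / 2}"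
    using p(2) n(2) B by auto
  have int: "(\<lambda>t. weight_right (sublevel h t)) integrable_on {0<..<pi / 2}" "(\<lambda>t. weight_left (sublevel h t)) integrable_on {0<..<pi / 2}"
    using pi ni set_lebesgue_integral_eq_integral(1) by blast+
  show "(\<lambda>t. weight (sublevel h t)) integrable_on {0<..<pi / 2}"
    unfolding weight_def using int by (rule integrable_add)
  show "continuous_on {0<..<pi / 2} (\<lambda>t. weight (sublevel h t))"
    unfolding weight_def using p(1) n(1) B by (intro continuous_on_add) auto
  show "period_at h = integral {0<..<pi / 2} (\<lambda>t. weight_right (sublevel h t)) + integral {0<..<pi / 2} (\<lambda>t. weight_left (sublevel h t))"
    unfolding period_at_def weight_def using int by (rule integral_add)
qed

lemma period_at_strict_antimono:
  assumes "p\<^sup>2 - p * q + q\<^sup>2 + 3 * p - 3 * q \<le> 0" "(p, q) \<notin> {(1, 2), (- 2, - 1), (- 2, 2)}"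
    and h: "0 < h" "h < h'" "h' \<le> H"
  shows "period_at h' < period_at h"
  unfolding period_at_def
proof (rule integral_less_open)
  fix t :: real assume t: "0 < t" "t < pi / 2"
  show "weight (sublevel h' t) < weight (sublevel h t)"
    using weight_strict_antimono[OF assms(1,2)] sublevel_bounds[of h t] sublevel_bounds[of h' t] sublevel_less[of h h' t] h t by auto
qed (use weight_sublevel(3,4) h in auto)

lemma period_at_mono_near_0:
  assumes "0 < p\<^sup>2 - p * q + q\<^sup>2 + 3 * p - 3 * q"
  obtains H' where "0 < H'" "H' \<le> H" "\<And>h h'. 0 < h \<Longrightarrow> h < h' \<Longrightarrow> h' < H' \<Longrightarrow> period_at h \<le> period_at h'"
proof -
  obtain H' where H': "0 < H'" "H' \<le> H" "\<And>h h'. 0 < h \<Longrightarrow> h < h' \<Longrightarrow> h' < H' \<Longrightarrow> weight h \<le> weight h'"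
    using weight_mono_near_0[OF assms] by blast
  have "period_at h \<le> period_at h'" if h: "0 < h" "h < h'" "h' < H'" for h h'
    unfolding period_at_def
  proof (rule integral_le)
    fix t :: real assume t: "t \<in> {0<..<pi / 2}"
    show "weight (sublevel h t) \<le> weight (sublevel h' t)"
      using H'(3) sublevel_bounds[of h t] sublevel_bounds[of h' t] sublevel_less[of h h' t] h t by auto
  qed (use weight_sublevel(3) h H' in auto)
  then show ?thesis using that H' by blast
qed

end

section \<open>Reduction of the period integral\<close>

context exponents begin

text \<open>Here \<open>z\<close> is \<zeta> and \<open>N\<close> is half the logarithm of
  \<open>M\<close>. Working from their differential equations alone treats the three forms of the
  radicand at once.\<close>

lemma theta_eq_period_at:
  fixes z N :: "real \<Rightarrow> real"
  assumes r: "1 < r"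
    and z': "\<And>x. 1 \<le> x \<Longrightarrow> x \<le> r \<Longrightarrow> (z has_real_derivative - (Q (z x) / x)) (at x)"
    and N': "\<And>x. 1 \<le> x \<Longrightarrow> x \<le> r \<Longrightarrow> (N has_real_derivative z x / x) (at x)"
    and N_ends: "N 1 = 0" "N r = 0"
    and admissible_z: "\<And>x. 1 \<le> x \<Longrightarrow> x \<le> r \<Longrightarrow> admissible (z x)"
    and rad: "\<And>x. 1 \<le> x \<Longrightarrow> x \<le> r \<Longrightarrow> period_radicand p q r x = x\<^sup>2 * (exp (2 * N x) - 1)"
  shows "level p q (z 1) (z r) \<and> Theta p q r = period_at (energy (z 1))"
proof -
  have z_less: "z y < z x" if "1 \<le> x" "x < y" "y \<le> r" for x y
  proof (rule DERIV_neg_imp_decreasing[OF that(2)])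
    fix w assume "x \<le> w" "w \<le> y"
    then show "\<exists>d. (z has_real_derivative d) (at w) \<and> d < 0"
      using z'[of w] Q_pos[OF admissible_z[of w]] that by (intro exI[of _ "- (Q (z w) / w)"]) auto
  qed
  have "continuous_on {1..r} N"
    using N' by (intro DERIV_continuous_on[where D = "\<lambda>x. z x / x"]) (auto intro: has_field_derivative_at_within)
  moreover have "N differentiable (at x)" if "1 < x" "x < r" for x
    using N'[of x] that by (auto simp: real_differentiable_def)
  \<comment> \<open>As \<open>N\<close> vanishes at both ends, its derivative \<open>z x / x\<close>
    has an interior zero \<open>m\<close>, where \<open>z\<close> changes sign.\<close>
  ultimately obtain m where m: "1 < m" "m < r" "(N has_real_derivative 0) (at m)"
    using Rolle[of 1 r N] r N_ends by auto
  have "z m / m = 0"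
    using DERIV_unique[OF N'[of m] m(3)] m by simp
  with m have m: "1 < m" "m < r" "z m = 0" by auto
  have z_sign: "0 < z x" if "1 \<le> x" "x < m" for x
    using z_less[of x m] that m by simp
  have z_sign': "z x < 0" if "m < x" "x \<le> r" for x
    using z_less[of m x] that m by simp
  \<comment> \<open>The two derivatives are \<open>- z y / y\<close> and \<open>z y / y\<close>, so
    the sum is constant; at 1 it is the height.\<close>
  have conserved: "energy (z x) + N x = energy (z 1)" if "1 \<le> x" "x \<le> r" for x
  proof -
    have "((\<lambda>x. energy (z x) + N x) has_real_derivative 0) (at y)" if "1 \<le> y" "y \<le> r" for y
    proof -
      have "((\<lambda>x. energy (z x)) has_real_derivative z y / Q (z y) * - (Q (z y) / y)) (at y)"
        by (rule DERIV_chain2[OF energy'[OF admissible_z[OF that]] z'[OF that]])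
      moreover have "z y / Q (z y) * - (Q (z y) / y) = - (z y / y)"
        using Q_pos[OF admissible_z[OF that]] by simp
      ultimately show ?thesis using N'[OF that] by (auto intro!: derivative_eq_intros)
    qed
    then have "(\<lambda>x. energy (z x) + N x) x = (\<lambda>x. energy (z x) + N x) 1"
      using that r by (intro DERIV_isconst2[of 1 r]) (auto intro!: continuous_at_imp_continuous_on DERIV_isCont)
    then show ?thesis using N_ends by simp
  qed
  have lev: "level p q (z 1) (z r)"
    using z_sign[of 1] z_sign'[of r] m r admissible_z conserved[of r] N_ends
    by unfold_locales auto
  interpret level p q "z 1" "z r" by (fact lev)
  define E where "E = exp (2 * H) - 1"
  define e where "e x = exp (2 * energy (z x)) - 1" for x
  define e' where "e' x = - (2 * exp (2 * energy (z x)) * z x / x)" for x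
  have E: "0 < E" using H_pos by (simp add: E_def)
  have e_der: "(e has_real_derivative e' x) (at x)" if "1 \<le> x" "x \<le> r" for x
  proof -
    have "(e has_real_derivative exp (2 * energy (z x)) * (2 * (z x / Q (z x) * - (Q (z x) / x)))) (at x)"
      unfolding e_def
      by (auto intro!: derivative_eq_intros DERIV_chain2[OF energy'[OF admissible_z[OF that]] z'[OF that]])
    then show ?thesis
      using Q_pos[OF admissible_z[OF that]] by (auto simp: e'_def elim!: DERIV_cong)
  qed
  have e_cont: "continuous_on {a..b} e" if "1 \<le> a" "b \<le> r" for a b
    using that by (intro continuous_at_imp_continuous_on ballI DERIV_isCont[OF e_der]) auto
  have e_vals: "e 1 = E" "e m = 0" "e r = E"
    using uv m by (auto simp: e_def E_def H_def energy_0)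
  have e_dec: "e y < e x" if "1 \<le> x" "x < y" "y \<le> m" for x y
    using energy_strict_mono[of "z y" "z x"] admissible_z[of x] admissible_z[of y] z_less[of x y] z_sign[of y] that m
    by (cases "y = m") (auto simp: e_def)
  have e_inc: "e x < e y" if "m \<le> x" "x < y" "y \<le> r" for x y
    using energy_strict_antimono[of "z y" "z x"] admissible_z[of x] admissible_z[of y] z_less[of x y] z_sign'[of x] that m
    by (cases "x = m") (auto simp: e_def)
  let ?F = "\<lambda>x. 1 / sqrt (period_radicand p q r x)"
  let ?w = "\<lambda>x. \<bar>e' x\<bar> / (2 * sqrt (e x) * sqrt (E - e x))"
  \<comment> \<open>By conservation the radicand is \<open>x\<^sup>2 * (E - e x)\<close> divided by
    \<open>exp (2 * energy (z x))\<close>. The integrand thus splits into the factor of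
    \<open>beta_substitution\<close> and a term that on each side of \<open>m\<close> is a function
    of the energy alone.\<close>
  have integrand: "?F x = ?w x * (sqrt (1 - exp (- (2 * energy (z x)))) / \<bar>z x\<bar>)"
    if x: "1 < x" "x < r" "x \<noteq> m" for x
  proof -
    define P where "P = energy (z x)"
    have e: "0 < e x" "e x < E"
      using e_dec[of 1 x] e_dec[of x m] e_inc[of m x] e_inc[of x r] e_vals x by (cases "x < m"; auto)+
    have z0: "z x \<noteq> 0" using z_sign[of x] z_sign'[of x] x by (cases "x < m") auto
    have "exp (2 * N x) - 1 = (E - e x) / (exp P)\<^sup>2"
      using conserved[of x] x
      by (simp add: E_def e_def H_def P_def diff_divide_distrib exp_diff[symmetric] exp_double[symmetric] algebra_simps)
    then have rt: "sqrt (period_radicand p q r x) = x * sqrt (E - e x) / exp P"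
      using rad[of x] x by (simp add: real_sqrt_mult real_sqrt_divide)
    have "1 - exp (- (2 * P)) = e x / (exp P)\<^sup>2"
      by (simp add: e_def P_def exp_minus exp_double[symmetric] field_simps)
    then have se: "sqrt (1 - exp (- (2 * P))) = sqrt (e x) / exp P"
      by (simp add: real_sqrt_divide)
    have ea: "\<bar>e' x\<bar> = 2 * (exp P)\<^sup>2 * \<bar>z x\<bar> / x"
      using x by (simp add: e'_def P_def abs_mult exp_double)
    have "0 < sqrt (e x)" "0 < sqrt (E - e x)" using e by auto
    then show ?thesis
      unfolding P_def[symmetric] rt se ea using z0 x by (simp add: field_simps power2_eq_square)
  qed
  have ln_e: "ln (1 + e x) / 2 = energy (z x)" for x by (simp add: e_def)
  have sublevel: "sublevel H t = ln (1 + E * (sin t)\<^sup>2) / 2" for t by (simp add: sublevel_def E_def)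
  note weight = weight_sublevel[OF H_pos order_refl]
  have "?F integrable_on {1<..<m} \<and> integral {1<..<m} ?F = integral {0<..<pi / 2} (\<lambda>t. weight_right (sublevel H t))"
  proof -
    have *: "?F x = ?w x * weight_right (ln (1 + e x) / 2)" if "x \<in> {1<..<m}" for x
      using integrand[of x] right_branch_energy[OF admissible_z[of x]] z_sign[of x] that m by (simp add: weight_right_def ln_e)
    have inj: "inj_on e {1<..<m}"
      using e_dec by (intro linorder_inj_onI') (metis greaterThanLessThan_iff less_imp_le less_irrefl)
    have img: "e ` {1<..<m} = {0<..<E}"
      using strict_antimono_image_open[OF m(1) e_cont e_dec] m e_vals by auto
    note beta = beta_substitution[OF E e_der inj img, of "\<lambda>s. weight_right (ln (1 + s) / 2)"]
    have int: "(\<lambda>x. ?w x * weight_right (ln (1 + e x) / 2)) integrable_on {1<..<m}"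
      using beta(1) weight(1) m by (auto simp: sublevel intro: set_lebesgue_integral_eq_integral(1))
    have val: "integral {1<..<m} (\<lambda>x. ?w x * weight_right (ln (1 + e x) / 2)) = integral {0<..<pi / 2} (\<lambda>t. weight_right (sublevel H t))"
      using beta(2) weight(1) m by (auto simp: sublevel)
    have "integral {1<..<m} ?F = integral {1<..<m} (\<lambda>x. ?w x * weight_right (ln (1 + e x) / 2))"
      by (rule integral_cong) (rule *)
    moreover have "?F integrable_on {1<..<m}"
      by (rule integrable_eq[OF int]) (rule *[symmetric])
    ultimately show ?thesis using val by simp
  qed
  moreover have "?F integrable_on {m<..<r} \<and> integral {m<..<r} ?F = integral {0<..<pi / 2} (\<lambda>t. weight_left (sublevel H t))"
  proof -
    have *: "?F x = ?w x * weight_left (ln (1 + e x) / 2)" if "x \<in> {m<..<r}" for x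
      using integrand[of x] left_branch_energy[OF admissible_z[of x]] z_sign'[of x] that m by (simp add: weight_left_def ln_e)
    have inj: "inj_on e {m<..<r}"
      using e_inc by (intro linorder_inj_onI') (metis greaterThanLessThan_iff less_imp_le less_irrefl)
    have img: "e ` {m<..<r} = {0<..<E}"
      using strict_mono_image_open[OF m(2) e_cont e_inc] m e_vals by auto
    note beta = beta_substitution[OF E e_der inj img, of "\<lambda>s. weight_left (ln (1 + s) / 2)"]
    have int: "(\<lambda>x. ?w x * weight_left (ln (1 + e x) / 2)) integrable_on {m<..<r}"
      using beta(1) weight(2) m by (auto simp: sublevel intro: set_lebesgue_integral_eq_integral(1))
    have val: "integral {m<..<r} (\<lambda>x. ?w x * weight_left (ln (1 + e x) / 2)) = integral {0<..<pi / 2} (\<lambda>t. weight_left (sublevel H t))"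
      using beta(2) weight(2) m by (auto simp: sublevel)
    have "integral {m<..<r} ?F = integral {m<..<r} (\<lambda>x. ?w x * weight_left (ln (1 + e x) / 2))"
      by (rule integral_cong) (rule *)
    moreover have "?F integrable_on {m<..<r}"
      by (rule integrable_eq[OF int]) (rule *[symmetric])
    ultimately show ?thesis using val by simp
  qed
  \<comment> \<open>Removing the finite set of \<open>1\<close>, \<open>m\<close>, \<open>r\<close>
    leaves two open intervals, on each of which a single branch inverts the energy.\<close>
  moreover have "Theta p q r = integral ({1<..<m} \<union> {m<..<r}) ?F"
    unfolding Theta_def
  proof (rule integral_spike_set)
    have "{1..r} - ({1<..<m} \<union> {m<..<r}) \<subseteq> {1, m, r}"
      using m by (auto simp: not_less)
    then show "negligible {x \<in> {1..r} - ({1<..<m} \<union> {m<..<r}). ?F x \<noteq> 0}"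
      by (intro negligible_subset[OF negligible_finite[of "{1, m, r}"]]) (simp, blast)
    have "({1<..<m} \<union> {m<..<r}) - {1..r} = {}" using m by auto
    then show "negligible {x \<in> ({1<..<m} \<union> {m<..<r}) - {1..r}. ?F x \<noteq> 0}" by (simp only: empty_iff) simp
  qed
  moreover have "{1<..<m} \<inter> {m<..<r} = {}" by auto
  ultimately have "Theta p q r = period_at (energy (z 1))"
    using weight(5) by (simp add: H_def)
  with lev show ?thesis by blast
qed

text \<open>The numerator has the sign of \<open>s\<close>; dividing by \<open>s\<close> spares case
  distinctions on the signs of \<open>p\<close> and \<open>q\<close>.\<close>

lemma powr_quotient_pos:
  assumes "1 < r" "s \<noteq> 0"
  shows "0 < (r powr s - 1) / (s :: real)"
proof (cases "0 < s")
  case True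
  then show ?thesis using assms by (simp add: powr_def)
next
  case False
  then have "s < 0" using assms by simp
  then show ?thesis using assms by (intro divide_neg_neg) (auto simp: powr_def mult_neg_pos)
qed

lemma powr_quotient_mono:
  assumes "1 \<le> x" "x \<le> r" "s \<noteq> 0"
  shows "(x powr s - 1) / s \<le> (r powr s - 1) / (s :: real)"
proof (cases "0 < s")
  case True
  then show ?thesis using assms by (intro divide_right_mono) (auto intro: powr_mono2)
next
  case False
  then have "s < 0" using assms by simp
  then show ?thesis using assms by (intro divide_right_mono_neg) (auto intro: powr_mono2')
qed

text \<open>
  Here \<open>u = \<zeta> 1\<close> and \<open>v = \<zeta> r\<close>. The relation between \<open>u\<close>, \<open>v\<close> and \<open>r\<close> determines the height
  \<open>h\<close> as an increasing function of \<open>r\<close>.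
\<close>

definition "represents r u v \<longleftrightarrow> level p q u v \<and> 1 + u = r powr (q - p) * (1 + v) \<and> Theta p q r = period_at (energy u)"

text \<open>\<open>G\<close> is the base of the outer power in the radicand, and \<open>z x\<close>
  is \<open>x\<close> times the derivative of \<open>N\<close>.\<close>

lemma represents_generic:
  assumes r: "1 < r" and p: "p \<noteq> 0" and q: "q \<noteq> 0"
  shows "\<exists>u v. represents r u v"
proof -
  define c where "c = (r powr q - 1) / (r powr p - 1)"
  define G where "G x = 1 + c * (x powr p - 1)" for x
  define z where "z x = c * p * x powr p / (q * G x) - 1" for x
  define N where "N x = ln (G x) / q - ln x" for x
  have rp: "r powr p - 1 \<noteq> 0" using powr_quotient_pos[OF r p] by auto
  \<comment> \<open>This gives \<open>- 1 < z x\<close> below, and the next fact gives the other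
    half of admissibility.\<close>
  have cpq: "0 < c * p / q"
  proof -
    have eq: "c * p / q = ((r powr q - 1) / q) / ((r powr p - 1) / p)" by (simp add: c_def)
    show ?thesis
      unfolding eq by (intro divide_pos_pos[OF powr_quotient_pos[OF r q] powr_quotient_pos[OF r p]])
  qed
  have pc: "0 < p * (c - 1)"
  proof -
    have eq: "p * (c - 1) = (r powr q - r powr p) / ((r powr p - 1) / p)"
      using rp p by (simp add: c_def field_simps)
    show ?thesis
      unfolding eq using r pq by (intro divide_pos_pos[OF _ powr_quotient_pos[OF r p]]) simp
  qed
  have G: "0 < G x" if x: "1 \<le> x" "x \<le> r" for x
  proof -
    \<comment> \<open>In terms of this parameter between 0 and 1, \<open>G x\<close> is a convex
      combination of 1 and \<open>r powr q\<close>.\<close>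
    define \<tau> where "\<tau> = ((x powr p - 1) / p) / ((r powr p - 1) / p)"
    have "0 \<le> (x powr p - 1) / p" using powr_quotient_mono[of 1 x p] x p by simp
    then have \<tau>: "0 \<le> \<tau>" "\<tau> \<le> 1"
      unfolding \<tau>_def using powr_quotient_mono[OF x p] powr_quotient_pos[OF r p]
      by (auto simp only: pos_divide_le_eq mult_1 intro: divide_nonneg_pos)
    have "G x = 1 + (r powr q - 1) * \<tau>"
      using p rp by (simp add: G_def c_def \<tau>_def)
    also have "\<dots> = (1 - \<tau>) + r powr q * \<tau>" by (simp add: algebra_simps)
    also have "\<dots> > 0" using \<tau> r by (cases "\<tau> = 0") (auto intro!: add_nonneg_pos)
    finally show ?thesis .
  qed
  have ends: "G 1 = 1" "G r = r powr q" using rp by (auto simp: G_def c_def)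
  have G': "(G has_real_derivative c * p * x powr p / x) (at x)" if "0 < x" for x
    unfolding G_def using that
    by (auto intro!: derivative_eq_intros simp: powr_diff)
  have qz: "q * z x + (q - p) = p * (c - 1) / G x" if "1 \<le> x" "x \<le> r" for x
    using G[OF that] q by (simp add: z_def field_simps) (simp add: G_def algebra_simps)
  have "level p q (z 1) (z r) \<and> Theta p q r = period_at (energy (z 1))"
  proof (rule theta_eq_period_at[where N = N])
    fix x assume x: "1 \<le> x" "x \<le> r"
    define Y where "Y = c * p * x powr p"
    \<comment> \<open>This is the quotient rule for \<open>z\<close>: at \<open>W = G x\<close> the
      two factors on the right are \<open>1 + z x\<close> and
      \<open>q * z x + (q - p)\<close>.\<close>
    have alg: "(p * Y / x * (q * W) - Y * (q * (Y / x))) / (q * W)\<^sup>2 = - (Y / (q * W) * ((Y - p * W) / W) / x)"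
      if "W \<noteq> 0" for W
      using that x q by (simp add: divide_simps power2_eq_square) (simp add: algebra_simps)
    have Y': "((\<lambda>x. c * p * x powr p) has_real_derivative p * Y / x) (at x)"
      unfolding Y_def using x by (auto intro!: derivative_eq_intros simp: powr_diff)
    have "(z has_real_derivative (p * Y / x * (q * G x) - Y * (q * (Y / x))) / (q * G x)\<^sup>2) (at x)"
      unfolding z_def
      using DERIV_diff[OF DERIV_divide[OF Y' DERIV_cmult[OF G'[of x], of q]] DERIV_const[of 1]] G[OF x] x q
      by (simp add: Y_def[symmetric] power2_eq_square)
    moreover have "Y / (q * G x) = 1 + z x" by (simp add: z_def Y_def)
    moreover have "(Y - p * G x) / G x = q * z x + (q - p)"
      unfolding qz[OF x] by (simp add: G_def Y_def algebra_simps)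
    ultimately show "(z has_real_derivative - (Q (z x) / x)) (at x)"
      unfolding Q_def using alg[of "G x"] G[OF x] by simp
    show "(N has_real_derivative z x / x) (at x)"
      unfolding N_def using G'[of x] G[OF x] x q
      by (auto intro!: derivative_eq_intros simp: z_def field_simps)
    have "0 < c * p / q * (x powr p / G x)"
      using G[OF x] x by (intro mult_pos_pos[OF cpq] divide_pos_pos) auto
    then have "0 < 1 + z x" by (simp add: z_def)
    then show "admissible (z x)" using qz[OF x] pc G[OF x] by (simp add: admissible_def)
    have "G x powr (2 / q) = x\<^sup>2 * exp (2 * N x)"
    proof -
      have "x\<^sup>2 = exp (2 * ln x)" using x by (simp add: exp_double)
      then show ?thesis using G[OF x] by (simp add: powr_def N_def exp_add[symmetric] algebra_simps)
    qed
    then show "period_radicand p q r x = x\<^sup>2 * (exp (2 * N x) - 1)"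
      using p q by (simp add: period_radicand_def G_def c_def algebra_simps)
  qed (use r q in \<open>auto simp: N_def ends ln_powr\<close>)
  \<comment> \<open>\<open>1 + z x\<close> is proportional to \<open>x powr p / G x\<close>, and
    \<open>G\<close> takes the values 1 and \<open>r powr q\<close> at the ends.\<close>
  moreover have "1 + z 1 = r powr (q - p) * (1 + z r)"
    using r q by (simp add: z_def ends powr_diff)
  ultimately show ?thesis unfolding represents_def by blast
qed

text \<open>The logarithm replaces the inner power. The factor \<open>q * z + (q - p)\<close>
  becomes \<open>q * (1 + z)\<close>, so the two admissibility conditions coincide.\<close>

lemma represents_p_0:
  assumes r: "1 < r" and p: "p = 0"
  shows "\<exists>u v. represents r u v"
proof -
  have q: "0 < q" using pq p by simp
  define c where "c = (r powr q - 1) / ln r"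
  define G where "G x = 1 + c * ln x" for x
  define z where "z x = c / (q * G x) - 1" for x
  define N where "N x = ln (G x) / q - ln x" for x
  have c: "0 < c" using r q by (simp add: c_def)
  have G: "0 < G x" if "1 \<le> x" for x using that c by (simp add: G_def add_pos_nonneg)
  have ends: "G 1 = 1" "G r = r powr q" using r by (auto simp: G_def c_def)
  have G': "(G has_real_derivative c / x) (at x)" if "0 < x" for x
    unfolding G_def using that by (auto intro!: derivative_eq_intros)
  have "level p q (z 1) (z r) \<and> Theta p q r = period_at (energy (z 1))"
  proof (rule theta_eq_period_at[where N = N])
    fix x assume x: "1 \<le> x" "x \<le> r"
    have "(z has_real_derivative - (c * (q * (c / x))) / (q * G x)\<^sup>2) (at x)"
      unfolding z_def using G'[of x] G[OF x(1)] x q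
      by (auto intro!: derivative_eq_intros simp: power2_eq_square)
    moreover have "- (c * (q * (c / x))) / (q * G x)\<^sup>2 = - ((c / (q * G x)) * (q * (c / (q * G x))) / x)"
      using G[OF x(1)] x q by (simp add: field_simps power2_eq_square)
    moreover have "c / (q * G x) = 1 + z x" by (simp add: z_def)
    moreover have "(1 + z x) * (q * (1 + z x)) = Q (z x)" unfolding Q_def using p by (simp add: algebra_simps)
    ultimately show "(z has_real_derivative - (Q (z x) / x)) (at x)"
      by (simp only:)
    show "(N has_real_derivative z x / x) (at x)"
      unfolding N_def using G'[of x] G[OF x(1)] x q
      by (auto intro!: derivative_eq_intros simp: z_def field_simps)
    have "0 < 1 + z x" using c q G[OF x(1)] by (simp add: z_def)
    moreover have "q * z x + (q - p) = q * (1 + z x)" using p by (simp add: algebra_simps)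
    ultimately show "admissible (z x)" unfolding admissible_def using q by simp
    have "G x powr (2 / q) = x\<^sup>2 * exp (2 * N x)"
    proof -
      have "x\<^sup>2 = exp (2 * ln x)" using x by (simp add: exp_double)
      then show ?thesis using G[OF x(1)] by (simp add: powr_def N_def exp_add[symmetric] algebra_simps)
    qed
    then show "period_radicand p q r x = x\<^sup>2 * (exp (2 * N x) - 1)"
      using p by (simp add: period_radicand_def G_def c_def algebra_simps)
  qed (use r q in \<open>auto simp: N_def ends ln_powr\<close>)
  moreover have "1 + z 1 = r powr (q - p) * (1 + z r)"
    using r q p by (simp add: z_def ends)
  ultimately show ?thesis unfolding represents_def by blast
qed

text \<open>Here \<open>Q z\<close> is the linear function \<open>- p * (1 + z)\<close>, and its
  second factor is the positive constant \<open>- p\<close>.\<close>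

lemma represents_q_0:
  assumes r: "1 < r" and q: "q = 0"
  shows "\<exists>u v. represents r u v"
proof -
  have p: "p < 0" using pq q by simp
  define c where "c = ln r / (r powr p - 1)"
  define z where "z x = c * p * x powr p - 1" for x
  define N where "N x = c * (x powr p - 1) - ln x" for x
  have rp: "r powr p - 1 \<noteq> 0" using powr_quotient_pos[OF r, of p] p by auto
  have cp: "0 < c * p"
  proof -
    have eq: "c * p = ln r / ((r powr p - 1) / p)" by (simp add: c_def)
    show ?thesis
      unfolding eq using r p by (intro divide_pos_pos[OF _ powr_quotient_pos[OF r]]) auto
  qed
  have "level p q (z 1) (z r) \<and> Theta p q r = period_at (energy (z 1))"
  proof (rule theta_eq_period_at[where N = N])
    fix x assume x: "1 \<le> x" "x \<le> r"
    have "(z has_real_derivative c * p * (p * x powr p / x)) (at x)"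
      unfolding z_def using x by (auto intro!: derivative_eq_intros simp: powr_diff)
    moreover have "c * p * (p * x powr p / x) = - (Q (z x) / x)"
      unfolding Q_def z_def using q by simp
    ultimately show "(z has_real_derivative - (Q (z x) / x)) (at x)" by simp
    show "(N has_real_derivative z x / x) (at x)"
      unfolding N_def using x by (auto intro!: derivative_eq_intros simp: z_def field_simps powr_diff)
    have "0 < 1 + z x" using cp x by (simp add: z_def)
    then show "admissible (z x)" unfolding admissible_def using q p by simp
    have expo: "2 * (x powr p - 1) / (r powr p - 1) * ln r = 2 * ln x + 2 * N x"
      unfolding N_def c_def by (simp add: right_diff_distrib mult.commute)
    have "r powr (2 * (x powr p - 1) / (r powr p - 1)) = x\<^sup>2 * exp (2 * N x)"
    proof -
      have "x\<^sup>2 = exp (2 * ln x)" using x by (simp add: exp_double)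
      moreover have "r powr (2 * (x powr p - 1) / (r powr p - 1))
          = exp (2 * (x powr p - 1) / (r powr p - 1) * ln r)"
        using r by (simp only: powr_def) simp
      ultimately show ?thesis by (simp only: expo exp_add)
    qed
    then show "period_radicand p q r x = x\<^sup>2 * (exp (2 * N x) - 1)"
      using p q by (simp add: period_radicand_def algebra_simps)
  qed (use r rp in \<open>auto simp: N_def c_def\<close>)
  moreover have "1 + z 1 = r powr (q - p) * (1 + z r)"
    using r unfolding q by (simp add: z_def powr_minus field_simps)
  ultimately show ?thesis unfolding represents_def by blast
qed

lemma represents_exists: "1 < r \<Longrightarrow> \<exists>u v. represents r u v"
  using represents_generic represents_p_0 represents_q_0 by blast

section \<open>The height as an increasing function of \<open>r\<close>, and the two directions of
  the theorem\<close>

lemma level_nested: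
  assumes "level p q u v" "level p q u' v'" "energy u \<le> energy u'"
  shows "u \<le> u'" "v' \<le> v"
proof -
  interpret a: level p q u v by fact
  interpret b: level p q u' v' by fact
  show "u \<le> u'"
  proof (rule ccontr)
    assume "\<not> u \<le> u'"
    then have "energy u' < energy u" using energy_strict_mono[of u' u] a.uv b.uv by simp
    then show False using assms(3) by simp
  qed
  show "v' \<le> v"
  proof (rule ccontr)
    assume "\<not> v' \<le> v"
    then have "energy v' < energy v" using energy_strict_antimono[of v v'] a.uv b.uv by simp
    then show False using assms(3) a.uv b.uv by simp
  qed
qed

text \<open>Otherwise the second level is nested in the first, so \<open>1 + u'\<close> is at most
  \<open>1 + u\<close>, hence at most \<open>r powr (q - p) * (1 + v')\<close>, which is less than
  \<open>1 + u'\<close>.\<close>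

lemma represents_energy_mono:
  assumes "level p q u v" "level p q u' v'" "0 < r" "r < r'"
    and "1 + u = r powr (q - p) * (1 + v)" "1 + u' = r' powr (q - p) * (1 + v')"
  shows "energy u < energy u'"
proof (rule ccontr)
  assume "\<not> energy u < energy u'"
  then have le: "u' \<le> u" "v \<le> v'" using level_nested[OF assms(2,1)] by auto
  have v': "0 < 1 + v'" using level.uv(4)[OF assms(2)] by (simp add: admissible_def)
  have "r powr (q - p) < r' powr (q - p)" using assms(3,4) pq by (intro powr_less_mono2) auto
  then have "r powr (q - p) * (1 + v') < r' powr (q - p) * (1 + v')" using v' by simp
  moreover have "r powr (q - p) * (1 + v) \<le> r powr (q - p) * (1 + v')" using le by (intro mult_left_mono) auto
  ultimately show False using assms(5,6) le by linarith
qed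

text \<open>A pair for \<open>r\<close> has only been shown to exist; nesting shows that its energy
  depends on \<open>r\<close> alone.\<close>

lemma represents_energy_eq:
  assumes "level p q u v" "level p q u' v'" "0 < r"
    and "1 + u = r powr (q - p) * (1 + v)" "1 + u' = r powr (q - p) * (1 + v')"
  shows "energy u = energy u'"
proof -
  have *: "u = u'" if "level p q u v" "level p q u' v'" "energy u \<le> energy u'"
     "1 + u = r powr (q - p) * (1 + v)" "1 + u' = r powr (q - p) * (1 + v')" for u v u' v'
  proof -
    have "u \<le> u'" "v' \<le> v" using level_nested[OF that(1-3)] by auto
    moreover have "r powr (q - p) * (1 + v') \<le> r powr (q - p) * (1 + v)"
      using calculation by (intro mult_left_mono) auto
    ultimately show ?thesis using that(4,5) by linarith
  qed
  show ?thesis using *[of u v u' v'] *[of u' v' u v] assms by (cases "energy u \<le> energy u'") auto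
qed

lemma theta_strict_antimono:
  assumes "p\<^sup>2 - p * q + q\<^sup>2 + 3 * p - 3 * q \<le> 0" "(p, q) \<notin> {(1, 2), (- 2, - 1), (- 2, 2)}"
    and r: "1 < r" "r < r'"
  shows "Theta p q r' < Theta p q r"
proof -
  obtain u v where 1: "level p q u v" "1 + u = r powr (q - p) * (1 + v)" "Theta p q r = period_at (energy u)"
    using represents_exists[OF r(1)] by (auto simp: represents_def)
  obtain u' v' where 2: "level p q u' v'" "1 + u' = r' powr (q - p) * (1 + v')" "Theta p q r' = period_at (energy u')"
    using represents_exists[of r'] r by (auto simp: represents_def)
  have less: "energy u < energy u'" using represents_energy_mono[OF 1(1) 2(1) _ r(2) 1(2) 2(2)] r by simp
  have "0 < energy u" using level.H_pos[OF 1(1)] level.H_def[OF 1(1)] by simp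
  then show ?thesis
    unfolding 1(3) 2(3) using level.period_at_strict_antimono[OF 2(1) assms(1,2) _ less] level.H_def[OF 2(1)] by simp
qed

text \<open>Solving the endpoint relation for \<open>r\<close> shows that every level comes from
  some \<open>r\<close>. This makes arbitrarily small heights accessible.\<close>

lemma theta_at_level:
  assumes lev: "level p q u v"
  defines "r \<equiv> ((1 + u) / (1 + v)) powr (1 / (q - p))"
  shows "1 < r" "1 + u = r powr (q - p) * (1 + v)" "Theta p q r = period_at (energy u)"
proof -
  interpret level p q u v by fact
  have v: "0 < 1 + v" using uv by (simp add: admissible_def)
  have ratio: "1 < (1 + u) / (1 + v)" using uv v by simp
  then show r: "1 < r" unfolding r_def using pq by (intro gr_one_powr) auto
  show eq: "1 + u = r powr (q - p) * (1 + v)"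
    unfolding r_def powr_powr using pq v uv by simp
  obtain u' v' where 2: "level p q u' v'" "1 + u' = r powr (q - p) * (1 + v')" "Theta p q r = period_at (energy u')"
    using represents_exists[OF r] by (auto simp: represents_def)
  show "Theta p q r = period_at (energy u)"
    unfolding 2(3) using represents_energy_eq[OF lev 2(1) _ eq 2(2)] r by simp
qed

text \<open>Near height 0 the period does not decrease, and two heights there are realised by two
  values of \<open>r\<close>.\<close>

lemma theta_not_strict_antimono:
  assumes "0 < p\<^sup>2 - p * q + q\<^sup>2 + 3 * p - 3 * q"
  obtains r r' where "1 < r" "r < r'" "Theta p q r \<le> Theta p q r'"
proof -
  \<comment> \<open>The value 2 is arbitrary; any level provides the branches near height 0.\<close>
  obtain u v where "level p q u v" using represents_exists[of 2] by (auto simp: represents_def)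
  then interpret level p q u v .
  obtain H' where H': "0 < H'" "H' \<le> H" "\<And>h h'. 0 < h \<Longrightarrow> h < h' \<Longrightarrow> h' < H' \<Longrightarrow> period_at h \<le> period_at h'"
    using period_at_mono_near_0[OF assms] by blast
  have lev: "level p q (right_branch h) (left_branch h)" "energy (right_branch h) = h" if h: "0 < h" "h < H" for h
  proof -
    show "level p q (right_branch h) (left_branch h)"
      using right_branch_props(1)[OF h] left_branch_props(1)[OF h] admissible_right_branch[OF h] admissible_left_branch[OF h] by unfold_locales auto
    show "energy (right_branch h) = h" using right_branch_props(1)[OF h] by simp
  qed
  define R where "R h = ((1 + right_branch h) / (1 + left_branch h)) powr (1 / (q - p))" for h
  have R: "1 < R h" "1 + right_branch h = R h powr (q - p) * (1 + left_branch h)" "Theta p q (R h) = period_at h" if h: "0 < h" "h < H" for h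
    using theta_at_level[OF lev(1)[OF h]] lev(2)[OF h] by (auto simp: R_def)
  define h h' where "h = H' / 3" and "h' = H' / 2"
  have h: "0 < h" "h < h'" "h' < H'" "h < H" "h' < H" "0 < h'" using H' by (auto simp: h_def h'_def)
  \<comment> \<open>A larger or equal \<open>R h\<close> would force the height \<open>h\<close> to
    be larger than or equal to \<open>h'\<close>.\<close>
  have "R h < R h'"
  proof (rule ccontr)
    assume "\<not> R h < R h'"
    then consider "R h' < R h" | "R h' = R h" by linarith
    then show False
    proof cases
      case 1
      then show False
        using represents_energy_mono[OF lev(1)[OF h(6,5)] lev(1)[OF h(1,4)] _ 1 R(2)[OF h(6,5)] R(2)[OF h(1,4)]]
          R(1)[OF h(6,5)] lev(2)[OF h(6,5)] lev(2)[OF h(1,4)] h(2) by simp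
    next
      case 2
      then show False
        using represents_energy_eq[OF lev(1)[OF h(6,5)] lev(1)[OF h(1,4)] _ R(2)[OF h(6,5), unfolded 2] R(2)[OF h(1,4)]]
          R(1)[OF h(1,4)] lev(2)[OF h(6,5)] lev(2)[OF h(1,4)] h(2) by simp
    qed
  qed
  moreover have "Theta p q (R h) \<le> Theta p q (R h')"
    unfolding R(3)[OF h(1,4)] R(3)[OF h(6,5)] by (rule H'(3)[OF h(1-3)])
  ultimately show ?thesis by (rule that[OF R(1)[OF h(1,4)]])
qed

end

theorem theorem3p3:
  fixes p q :: real
  assumes "q > p"
    and "(p, q) \<notin> {(1, 2), (- 2, - 1), (- 2, 2)}"
  shows "strict_antimono_on {1<..} (\<lambda>r. Theta p q r) \<longleftrightarrow>
    p\<^sup>2 - p * q + q\<^sup>2 + 3 * p - 3 * q \<le> 0"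
proof -
  interpret exponents p q using assms(1) by unfold_locales
  show ?thesis
  proof
    assume mono: "strict_antimono_on {1<..} (\<lambda>r. Theta p q r)"
    show "p\<^sup>2 - p * q + q\<^sup>2 + 3 * p - 3 * q \<le> 0"
    proof (rule ccontr)
      assume "\<not> ?thesis"
      then have "0 < p\<^sup>2 - p * q + q\<^sup>2 + 3 * p - 3 * q" by (simp only: not_le)
      then obtain r r' where r: "1 < r" "r < r'" "Theta p q r \<le> Theta p q r'"
        by (rule theta_not_strict_antimono)
      moreover have "Theta p q r' < Theta p q r"
        using monotone_onD[OF mono, of r r'] r by simp
      ultimately show False by simp
    qed
  next
    assume "p\<^sup>2 - p * q + q\<^sup>2 + 3 * p - 3 * q \<le> 0"
    then show "strict_antimono_on {1<..} (\<lambda>r. Theta p q r)"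
      using theta_strict_antimono[OF _ assms(2)] by (simp add: monotone_on_def)
  qed
qed

end
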